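(* Let $k\in\mathbb{N}$ with $1\le k<N$, let $\Omega\subset\mathbb{R}^N$ be open, and let $U$ be a smooth subdomain of $\Omega$, that is, an open subset of $\Omega$ whose relative boundary $\Omega\cap\partial U$ can be represented locally as the graph of a smooth function. Let $\kappa_1\le\kappa_2\le\dots\le\kappa_{N-1}$ denote the principal curvatures of $\Omega\cap\partial U$. Then $$\kappa_{N-k}\ge 0\quad\text{on }\Omega\cap\partial U$$ if and only if condition (G$_{\lambda_k,\Omega,U}$) holds.
   Context: For a real symmetric $N\times N$ matrix $X$, $\lambda_1(X)\le\dots\le\lambda_N(X)$ denote its eigenvalues in nondecreasing order. Condition (G$_{\lambda_k,\Omega,U}$): if $\phi\in C^2(\Omega)$, $\hat x\in\Omega\setminus U$ and $\phi\le\phi(\hat x)=0$ in $\Omega\setminus U$, then $\lambda_k(D^2\phi(\hat x))\le 0$. Local graph representation and sign convention for the principal curvatures: $U$ lies locally on one side of its relative boundary, in the sense that for every point of $\Omega\cap\partial U$, after a rigid transformation moving this point to the origin, there are $r>0$ with $B_r\subset\Omega$ and $f\in C^2(B_r^{N-1})$ with $f(0)=0$, $Df(0)=0$ such that $U\cap B_r=\{x=(x',x_N)\in B_r : x_N>f(x')\}$; the principal curvatures at this point are the eigenvalues of $D^2f(0)$. Here $B_r$ and $B_r^{N-1}$ are the open balls of radius $r$ centered at the origin in $\mathbb{R}^N$ and $\mathbb{R}^{N-1}$. *)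

theory Defs
  imports "HOL-Analysis.Analysis" "HOL-Computational_Algebra.Polynomial"
begin

definition characteristic_poly :: "real ^ 'n ^ 'n \<Rightarrow> real poly" where
  "characteristic_poly A = det (\<chi> i j. (if i = j then [:0, 1:] else 0) - [:A $ i $ j:])"

text \<open>
  \<open>nth_eigenvalue k A\<close> is \<open>\<lambda>\<^sub>k(A)\<close>, counted from \<open>k = 1\<close> and with multiplicity. It is meaningful
  for symmetric \<open>A\<close> and \<open>1 \<le> k \<le> N\<close>: only then are all \<open>N\<close> roots of the characteristic
  polynomial guaranteed to be real, so that the sorted list has length \<open>N\<close>.
\<close>

definition nth_eigenvalue :: "nat \<Rightarrow> real ^ 'n ^ 'n \<Rightarrow> real" where
  "nth_eigenvalue k A = sorted_list_of_multiset (proots (characteristic_poly A)) ! (k - 1)"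

definition gradient :: "(real ^ 'n \<Rightarrow> real) \<Rightarrow> real ^ 'n \<Rightarrow> real ^ 'n" where
  "gradient f x = (\<chi> i. frechet_derivative f (at x) (axis i 1))"

definition hessian :: "(real ^ 'n \<Rightarrow> real) \<Rightarrow> real ^ 'n \<Rightarrow> real ^ 'n ^ 'n" where
  "hessian f x = jacobian (gradient f) (at x)"

text \<open>
  Used for open \<open>S\<close> only; the values of \<open>f\<close> outside \<open>S\<close> are then irrelevant.
\<close>

definition C2_on :: "(real ^ 'n) set \<Rightarrow> (real ^ 'n \<Rightarrow> real) \<Rightarrow> bool" where
  "C2_on S f \<longleftrightarrow>
     (\<forall>x\<in>S. f differentiable (at x)) \<and>
     (\<forall>x\<in>S. gradient f differentiable (at x)) \<and>
     continuous_on S (hessian f)"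

definition condition_G :: "nat \<Rightarrow> (real ^ 'n) set \<Rightarrow> (real ^ 'n) set \<Rightarrow> bool" where
  "condition_G k \<Omega> U \<longleftrightarrow>
     (\<forall>\<phi> xh. C2_on \<Omega> \<phi> \<and> xh \<in> \<Omega> - U \<and> \<phi> xh = 0 \<and> (\<forall>x \<in> \<Omega> - U. \<phi> x \<le> \<phi> xh) \<longrightarrow>
        nth_eigenvalue k (hessian \<phi> xh) \<le> 0)"

text \<open>
  Points of \<open>\<real>\<^sup>N\<close> are of type \<open>real ^ 'n\<close>. The coordinates \<open>(x', x\<^sub>N)\<close> in which \<open>U\<close> is a supergraph
  are of type \<open>(real ^ 'm) \<times> real\<close>, whose norm is again the Euclidean one. The definitions below are
  intended for \<open>CARD('n) = CARD('m) + 1\<close>, which makes a norm-preserving linear map between the two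
  spaces bijective.
\<close>

definition rigid_transformation :: "(real ^ 'n \<Rightarrow> (real ^ 'm) \<times> real) \<Rightarrow> bool" where
  "rigid_transformation T \<longleftrightarrow>
     (\<exists>Q b. linear Q \<and> (\<forall>x. norm (Q x) = norm x) \<and> (\<forall>x. T x = Q x + b))"

definition local_graph ::
  "(real ^ 'n) set \<Rightarrow> (real ^ 'n) set \<Rightarrow> real ^ 'n \<Rightarrow>
   (real ^ 'n \<Rightarrow> (real ^ 'm) \<times> real) \<Rightarrow> real \<Rightarrow> (real ^ 'm \<Rightarrow> real) \<Rightarrow> bool" where
  "local_graph \<Omega> U p T r f \<longleftrightarrow>
     rigid_transformation T \<and> T p = 0 \<and>
     r > 0 \<and> ball 0 r \<subseteq> T ` \<Omega> \<and>
     C2_on (ball 0 r) f \<and> f 0 = 0 \<and> gradient f 0 = 0 \<and>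
     T ` U \<inter> ball 0 r = {(x', xN). (x', xN) \<in> ball 0 r \<and> xN > f x'}"

definition smooth_subdomain ::
  "'m::finite itself \<Rightarrow> (real ^ 'n) set \<Rightarrow> (real ^ 'n) set \<Rightarrow> bool" where
  "smooth_subdomain _ \<Omega> U \<longleftrightarrow>
     open U \<and> U \<subseteq> \<Omega> \<and>
     (\<forall>p \<in> \<Omega> \<inter> frontier U. \<exists>T r (f :: real ^ 'm \<Rightarrow> real). local_graph \<Omega> U p T r f)"

text \<open>
  The values \<open>\<kappa> 1 \<le> \<dots> \<le> \<kappa> (N - 1)\<close> do not depend on the local graph representation chosen at \<open>p\<close>.
\<close>

definition principal_curvatures_at ::
  "'m::finite itself \<Rightarrow> (real ^ 'n) set \<Rightarrow> (real ^ 'n) set \<Rightarrow> real ^ 'n \<Rightarrow> (nat \<Rightarrow> real) \<Rightarrow> bool" where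
  "principal_curvatures_at _ \<Omega> U p \<kappa> \<longleftrightarrow>
     (\<exists>T r (f :: real ^ 'm \<Rightarrow> real). local_graph \<Omega> U p T r f \<and>
        (\<forall>j \<in> {1..CARD('m)}. \<kappa> j = nth_eigenvalue j (hessian f 0)))"

end

theory Submission
  imports Defs
begin

text \<open>
  By the spectral theorem, \<open>\<lambda>\<^sub>k(A) \<le> 0\<close> as soon as the quadratic form of \<open>A\<close> is nonpositive on a
  \<open>k\<close>-dimensional subspace, and \<open>\<lambda>\<^sub>k(A) > 0\<close> as soon as it is positive on a subspace of dimension
  \<open>N - k + 1\<close>; conversely such subspaces can be read off an eigenbasis.

  If \<open>\<kappa>\<^sub>N\<^sub>-\<^sub>k \<ge> 0\<close> at a boundary point, then \<open>D\<^sup>2f(0)\<close> is nonnegative on a \<open>k\<close>-dimensional space of tangent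
  vectors \<open>v\<close>. In graph coordinates the parabola \<open>t \<mapsto> (tv, -\<epsilon>t\<^sup>2)\<close> then stays outside \<open>U\<close> for small \<open>t\<close>, so
  the second order condition for \<open>\<phi>\<close> along it, with \<open>\<epsilon> \<rightarrow> 0\<close>, gives \<open>D\<^sup>2\<phi>(v, v) \<le> 0\<close>.

  If \<open>\<kappa>\<^sub>N\<^sub>-\<^sub>k < 0\<close>, write \<open>H = D\<^sup>2f(0)\<close>. The polynomial
  \<open>x\<^sub>N - H(x', x') / 2 - \<epsilon>|x'|\<^sup>2 + x\<^sub>N\<^sup>2 / 2 - K|x|\<^sup>4\<close> is nonpositive outside \<open>U\<close>: near the origin by the Taylor
  expansion of \<open>f\<close>, elsewhere because \<open>K\<close> is large. Its Hessian at the origin is positive on the sum of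
  the negative space of \<open>H\<close> and the normal direction, which has dimension \<open>N - k + 1\<close>.
\<close>

subsection \<open>Eigenvalues of symmetric matrices\<close>

text \<open>First variation at the minimum \<open>t = 0\<close>: near \<open>0\<close> the linear
  term dominates the quadratic one. It turns maximality of a Rayleigh quotient into an eigenvalue
  equation.\<close>

lemma linear_coeff_zero_if_quadratic_nonneg:
  fixes a b :: real
  assumes "\<And>t. 0 \<le> a * t + b * t\<^sup>2"
  shows "a = 0"
proof (rule ccontr)
  assume "a \<noteq> 0"
  \<comment> \<open>Any positive \<open>c > b\<close> would do: at \<open>t = - a / c\<close> the
    factor \<open>b / c - 1\<close> is then negative.\<close>
  define c where "c = \<bar>b\<bar> + 1"
  have "c > 0" by (simp add: c_def)
  have "0 \<le> a * (- a / c) + b * (- a / c)\<^sup>2" by (rule assms)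
  also have "\<dots> = a\<^sup>2 / c * (b / c - 1)"
    using \<open>c > 0\<close> by (simp add: divide_simps) algebra
  also have "\<dots> < 0"
    using \<open>a \<noteq> 0\<close> \<open>c > 0\<close> by (intro mult_pos_neg) (auto simp: c_def field_simps)
  finally show False by simp
qed

text \<open>The Rayleigh quotient attains its maximum on the compact unit sphere of
  \<open>S\<close>. Vanishing of its first variation at the maximizer is the eigenvalue
  equation.\<close>

lemma selfadjoint_eigenvector_exists:
  fixes f :: "'a::euclidean_space \<Rightarrow> 'a"
  assumes f: "linear f" and sa: "\<And>x y. f x \<bullet> y = x \<bullet> f y"
    and S: "subspace S" "f ` S \<subseteq> S" "S \<noteq> {0}"
  obtains v c where "v \<in> S" "norm v = 1" "f v = c *\<^sub>R v"
proof -
  let ?K = "S \<inter> sphere 0 1"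
  obtain s where "s \<in> S" "s \<noteq> 0" using S subspace_0 by blast
  then have "s /\<^sub>R norm s \<in> ?K"
    by (simp add: S subspace_scale)
  then have "?K \<noteq> {}" by blast
  moreover have "compact ?K"
    using closed_subspace[OF S(1)] by (simp add: closed_Int_compact)
  moreover have "continuous_on ?K (\<lambda>x. f x \<bullet> x)"
    by (intro continuous_intros linear_continuous_on linear_conv_bounded_linear[THEN iffD1] f)
  ultimately obtain v where v: "v \<in> ?K" and max: "\<And>x. x \<in> ?K \<Longrightarrow> f x \<bullet> x \<le> f v \<bullet> v"
    using continuous_attains_sup[of ?K "\<lambda>x. f x \<bullet> x"] by blast
  define c where "c = f v \<bullet> v"
  have le: "f x \<bullet> x \<le> c * (x \<bullet> x)" if "x \<in> S" for x
  proof (cases "x = 0")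
    case True
    then show ?thesis using linear_0[OF f] by simp
  next
    case False
    then have "x /\<^sub>R norm x \<in> ?K" using that by (simp add: S subspace_scale)
    from max[OF this] have "f x \<bullet> x / (x \<bullet> x) \<le> c"
      by (simp add: linear_cmul[OF f] c_def dot_square_norm power2_eq_square divide_inverse mult.assoc mult.commute[of "f x \<bullet> x"])
    then show ?thesis using False by (simp add: field_simps)
  qed
  \<comment> \<open>The residual of the eigenvalue equation is itself an admissible direction, since
    \<open>S\<close> is invariant. The first variation along it is twice its squared norm.\<close>
  define w where "w = c *\<^sub>R v - f v"
  have "w \<in> S" using v S by (auto simp: w_def intro!: subspace_diff subspace_scale)
  have "2 * (w \<bullet> w) = 0"
  proof (rule linear_coeff_zero_if_quadratic_nonneg)
    fix t :: real
    have "v + t *\<^sub>R w \<in> S" using v \<open>w \<in> S\<close> S by (auto intro!: subspace_add subspace_scale)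
    from le[OF this] have "0 \<le> c * ((v + t *\<^sub>R w) \<bullet> (v + t *\<^sub>R w)) - f (v + t *\<^sub>R w) \<bullet> (v + t *\<^sub>R w)"
      by simp
    also have "\<dots> = (c * (v \<bullet> v) - f v \<bullet> v) + t * (2 * (c * (v \<bullet> w)) - f v \<bullet> w - f w \<bullet> v)
        + t\<^sup>2 * (c * (w \<bullet> w) - f w \<bullet> w)"
      by (simp add: linear_add[OF f] linear_cmul[OF f] inner_simps inner_commute power2_eq_square algebra_simps)
    also have "c * (v \<bullet> v) - f v \<bullet> v = 0"
      using v by (simp add: c_def dot_square_norm)
    also have "f w \<bullet> v = f v \<bullet> w" using sa by (simp add: inner_commute)
    also have "2 * (c * (v \<bullet> w)) - f v \<bullet> w - f v \<bullet> w = 2 * (w \<bullet> w)"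
      by (simp add: w_def inner_simps inner_commute algebra_simps)
    finally show "0 \<le> 2 * (w \<bullet> w) * t + (c * (w \<bullet> w) - f w \<bullet> w) * t\<^sup>2"
      by (simp add: algebra_simps)
  qed
  then have "f v = c *\<^sub>R v" by (simp add: w_def)
  with v that show thesis by auto
qed

text \<open>Induction on the dimension: split off one eigenvector; its orthogonal complement in
  \<open>S\<close> is again invariant because \<open>f\<close> is self-adjoint. General invariant
  subspaces are what the induction runs over.\<close>

lemma selfadjoint_orthonormal_eigenvectors:
  fixes f :: "'a::euclidean_space \<Rightarrow> 'a"
  assumes f: "linear f" and sa: "\<And>x y. f x \<bullet> y = x \<bullet> f y"
    and S: "subspace S" "f ` S \<subseteq> S"
  shows "\<exists>B\<subseteq>S. finite B \<and> card B = dim S \<and> pairwise orthogonal B \<and> (\<forall>b\<in>B. norm b = 1)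
    \<and> (\<forall>b\<in>B. \<exists>c. f b = c *\<^sub>R b)"
  using S
proof (induction "dim S" arbitrary: S)
  case 0
  then show ?case by (intro exI[of _ "{}"]) auto
next
  case (Suc n S)
  then have "S \<noteq> {0}" by auto
  then obtain v c where v: "v \<in> S" "norm v = 1" "f v = c *\<^sub>R v"
    using selfadjoint_eigenvector_exists[OF f sa Suc.prems] by blast
  define S' where "S' = {y \<in> S. \<forall>x \<in> span {v}. orthogonal x y}"
  have "v \<noteq> 0" using v by auto
  then have "dim (span {v}) = 1" by (simp add: dim_eq_card_independent)
  moreover have "dim S' + dim (span {v}) = dim S" unfolding S'_def
    using v Suc.prems by (intro dim_subspace_orthogonal_to_vectors) (auto simp: span_minimal)
  ultimately have dimS': "n = dim S'" using Suc.hyps by simp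
  have sub: "subspace S'" unfolding S'_def using Suc.prems(1)
    by (auto simp: subspace_def orthogonal_clauses)
  have "f ` S' \<subseteq> S'"
  proof (clarsimp simp: S'_def, intro conjI ballI)
    fix y x assume y: "y \<in> S" "\<forall>x\<in>span {v}. orthogonal x y"
    show "f y \<in> S" using y Suc.prems by auto
    assume "x \<in> span {v}"
    then obtain a where "x = a *\<^sub>R v" by (auto simp: span_singleton)
    then have "f x = c *\<^sub>R x" by (simp add: linear_cmul[OF f] v)
    then show "orthogonal x (f y)"
      using sa[of x y] y \<open>x \<in> span {v}\<close> by (simp add: orthogonal_def)
  qed
  from Suc.hyps(1)[OF dimS' sub this] obtain B where B: "B \<subseteq> S'" "finite B" "card B = dim S'"
    "pairwise orthogonal B" "\<forall>b\<in>B. norm b = 1" "\<forall>b\<in>B. \<exists>c. f b = c *\<^sub>R b"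
    by blast
  have orth: "orthogonal v b" if "b \<in> B" for b
    using that B span_base[of v "{v}"] by (auto simp: S'_def)
  then have "v \<notin> B" using \<open>v \<noteq> 0\<close> orthogonal_self by blast
  show ?case
  proof (intro exI[of _ "insert v B"] conjI)
    show "insert v B \<subseteq> S" using B v by (auto simp: S'_def)
    show "card (insert v B) = dim S" using B \<open>v \<notin> B\<close> dimS' Suc.hyps(2) by simp
    show "pairwise orthogonal (insert v B)"
      using B(4) orth by (auto simp: pairwise_insert orthogonal_commute)
  qed (use B v in auto)
qed

lemma symmetric_matrix_inner:
  fixes A :: "real ^ 'n ^ 'n"
  assumes "transpose A = A"
  shows "(A *v x) \<bullet> y = x \<bullet> (A *v y)"
  by (metis assms dot_lmul_matrix vector_transpose_matrix)

text \<open>The basis is indexed by the type \<open>'n\<close> itself, so that its vectors can serve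
  as the rows of a square matrix and eigenvalues are counted with multiplicity by counting
  indices.\<close>

lemma symmetric_matrix_eigenbasis:
  fixes A :: "real ^ 'n ^ 'n"
  assumes A: "transpose A = A"
  obtains v :: "'n \<Rightarrow> real ^ 'n" and \<mu> :: "'n \<Rightarrow> real"
  where "\<And>i j. v i \<bullet> v j = (if i = j then 1 else 0)" "\<And>i. A *v v i = \<mu> i *\<^sub>R v i"
proof -
  obtain B :: "(real ^ 'n) set" where B: "finite B" "card B = CARD('n)"
    "pairwise orthogonal B" "\<forall>b\<in>B. norm b = 1" "\<forall>b\<in>B. \<exists>c. A *v b = c *\<^sub>R b"
    using selfadjoint_orthonormal_eigenvectors[of "(*v) A" UNIV] symmetric_matrix_inner[OF A]
    by (auto simp: dim_UNIV)
  then obtain v :: "'n \<Rightarrow> real ^ 'n" where v: "bij_betw v UNIV B"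
    by (metis B(1,2) finite finite_same_card_bij)
  then have vB: "v i \<in> B" for i by (auto simp: bij_betw_def)
  have "\<forall>i. \<exists>c. A *v v i = c *\<^sub>R v i" using B(5) vB by blast
  from choice[OF this] obtain \<mu> where "\<And>i. A *v v i = \<mu> i *\<^sub>R v i"
    by blast
  moreover have "v i \<bullet> v j = (if i = j then 1 else 0)" for i j
  proof (cases "i = j")
    case True
    then show ?thesis using B(4) vB by (simp add: dot_square_norm)
  next
    case False
    then have "v i \<noteq> v j" using v by (auto simp: bij_betw_def inj_on_def)
    then show ?thesis using B(3) vB False by (auto simp: pairwise_def orthogonal_def)
  qed
  ultimately show thesis using that by blast
qed

section \<open>Roots of the characteristic polynomial\<close>

lemma poly_det:
  fixes M :: "'a::comm_ring_1 poly ^ 'n ^ 'n"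
  shows "poly (det M) x = det (\<chi> i j. poly (M $ i $ j) x)"
  by (simp add: det_def poly_sum poly_prod)

text \<open>The orthogonal matrix \<open>P\<close> with rows \<open>v i\<close> conjugates
  \<open>x I - A\<close> to a diagonal matrix without changing its determinant. Both polynomials
  therefore have the same value at every real \<open>x\<close>.\<close>

lemma characteristic_poly_eigenbasis:
  fixes A :: "real ^ 'n ^ 'n" and v :: "'n \<Rightarrow> real ^ 'n"
  assumes orth: "\<And>i j. v i \<bullet> v j = (if i = j then 1 else 0)"
    and eig: "\<And>i. A *v v i = \<mu> i *\<^sub>R v i"
  shows "characteristic_poly A = (\<Prod>i\<in>UNIV. [:- \<mu> i, 1:])"
proof -
  define P :: "real ^ 'n ^ 'n" where "P = (\<chi> i. v i)"
  have P: "P ** transpose P = mat 1"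
    using orth by (simp add: P_def matrix_matrix_mult_def transpose_def mat_def vec_eq_iff inner_vec_def)
  have detP: "det P * det (transpose P) = 1"
    by (metis P det_I det_mul)
  have "poly (characteristic_poly A) x = poly (\<Prod>i\<in>UNIV. [:- \<mu> i, 1:]) x" for x
  proof -
    define C where "C = x *\<^sub>R mat 1 - A"
    have C: "(\<chi> i j. poly (((if i = j then [:0, 1:] else 0) - [:A $ i $ j:])) x) = C"
      by (auto simp: C_def vec_eq_iff mat_def)
    have Cv: "C *v v j = (x - \<mu> j) *\<^sub>R v j" for j
      by (simp add: C_def matrix_vector_mult_diff_rdistrib eig scaleR_matrix_vector_assoc[symmetric] algebra_simps)
    have D: "(P ** (C ** transpose P)) $ i $ j = (if i = j then x - \<mu> i else 0)" for i j
    proof -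
      have "(P ** (C ** transpose P)) $ i $ j = v i \<bullet> (C *v v j)"
        by (simp add: P_def matrix_matrix_mult_def transpose_def inner_vec_def matrix_vector_mult_def)
      then show ?thesis using orth by (simp add: Cv)
    qed
    have "det C = det (P ** (C ** transpose P))"
      using detP by (simp add: det_mul algebra_simps)
    also have "\<dots> = (\<Prod>i\<in>UNIV. x - \<mu> i)"
      by (subst det_diagonal) (simp_all add: D)
    also have "\<dots> = poly (\<Prod>i\<in>UNIV. [:- \<mu> i, 1:]) x" by (simp add: poly_prod)
    also have "det C = poly (characteristic_poly A) x"
      by (simp only: characteristic_poly_def poly_det C vec_lambda_beta)
    finally show ?thesis .
  qed
  then show ?thesis by (intro poly_eq_poly_eq_iff[THEN iffD1] ext)
qed

text \<open>The sorted root list is a rearrangement of the family \<open>\<mu>\<close>, so counting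
  indices of \<open>\<mu>\<close> amounts to counting list positions. Repeated eigenvalues can make
  both counts exceed these bounds.\<close>

lemma nth_eigenvalue_count:
  fixes A :: "real ^ 'n ^ 'n" and v :: "'n \<Rightarrow> real ^ 'n"
  assumes orth: "\<And>i j. v i \<bullet> v j = (if i = j then 1 else 0)"
    and eig: "\<And>i. A *v v i = \<mu> i *\<^sub>R v i"
    and k: "1 \<le> k" "k \<le> CARD('n)"
  shows "k \<le> card {i. \<mu> i \<le> nth_eigenvalue k A}"
    and "CARD('n) + 1 \<le> k + card {i. nth_eigenvalue k A \<le> \<mu> i}"
proof -
  define xs where "xs = sorted_list_of_multiset (proots (characteristic_poly A))"
  have "proots (characteristic_poly A) = (\<Sum>i\<in>UNIV. {#\<mu> i#})"
    by (simp add: characteristic_poly_eigenbasis[OF orth eig] proots_prod)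
  also have "\<dots> = image_mset \<mu> (mset_set UNIV)"
    by (simp add: sum_unfold_sum_mset image_mset.compositionality o_def)
  finally have mset: "mset xs = image_mset \<mu> (mset_set UNIV)"
    by (simp add: xs_def)
  have "length xs = CARD('n)" by (metis mset size_mset size_image_mset finite size_mset_set)
  have "sorted xs" by (simp add: xs_def)
  have card: "card {i. Q (\<mu> i)} = card {j. j < length xs \<and> Q (xs ! j)}" for Q
  proof -
    have "card {i. Q (\<mu> i)} = size (filter_mset Q (mset xs))"
      by (simp add: mset filter_mset_image_mset)
    also have "\<dots> = card {j. j < length xs \<and> Q (xs ! j)}"
      by (metis length_filter_conv_card mset_filter size_mset)
    finally show ?thesis .
  qed
  have ev: "nth_eigenvalue k A = xs ! (k - 1)" by (simp add: nth_eigenvalue_def xs_def)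
  have "{..<k} \<subseteq> {j. j < length xs \<and> xs ! j \<le> xs ! (k - 1)}"
    using k \<open>length xs = _\<close> \<open>sorted xs\<close> by (auto intro!: sorted_nth_mono)
  from card_mono[OF _ this] show "k \<le> card {i. \<mu> i \<le> nth_eigenvalue k A}"
    by (simp add: card[of "\<lambda>y. y \<le> _"] ev)
  \<comment> \<open>List positions start at \<open>0\<close>, so the \<open>k\<close>-th entry sits
    at \<open>k - 1\<close> and belongs to both the lower and the upper range. This overlap is the
    source of the extra \<open>1\<close>.\<close>
  have "{k - 1..<length xs} \<subseteq> {j. j < length xs \<and> xs ! (k - 1) \<le> xs ! j}"
    using k \<open>length xs = _\<close> \<open>sorted xs\<close> by (auto intro!: sorted_nth_mono)
  from card_mono[OF _ this] show "CARD('n) + 1 \<le> k + card {i. nth_eigenvalue k A \<le> \<mu> i}"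
    using k \<open>length xs = _\<close> by (simp add: card[of "\<lambda>y. _ \<le> y"] ev)
qed

section \<open>Quadratic forms in an eigenbasis and sign tests for the \<open>k\<close>-th
  eigenvalue\<close>

lemma orthonormal_eigenbasis_form:
  fixes A :: "real ^ 'n ^ 'n" and v :: "'n \<Rightarrow> real ^ 'n"
  assumes orth: "\<And>i j. v i \<bullet> v j = (if i = j then 1 else 0)"
    and eig: "\<And>i. A *v v i = \<mu> i *\<^sub>R v i"
  shows "x \<bullet> x = (\<Sum>i\<in>UNIV. (x \<bullet> v i)\<^sup>2)" "(A *v x) \<bullet> x = (\<Sum>i\<in>UNIV. \<mu> i * (x \<bullet> v i)\<^sup>2)"
    and "dim (span (v ` I)) = card I" "x \<in> span (v ` I) \<Longrightarrow> i \<notin> I \<Longrightarrow> x \<bullet> v i = 0"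
proof -
  have inj: "inj_on v J" for J
    by (rule inj_onI) (metis orth zero_neq_one)
  have norm1: "norm (v i) = 1" for i using orth[of i i] by (simp add: norm_eq_1)
  then have v0: "0 \<notin> v ` J" for J by (metis imageE norm_zero zero_neq_one)
  have pw: "pairwise orthogonal (v ` J)" for J
    using orth by (auto simp: pairwise_def orthogonal_def)
  show dim: "dim (span (v ` J)) = card J" for J
    using pairwise_orthogonal_independent[OF pw v0] by (simp add: dim_eq_card_independent card_image inj)
  have "span (range v) = UNIV"
    using dim[of UNIV] by (metis dim_eq_full dim_span DIM_cart DIM_real mult.right_neutral)
  then have "(\<Sum>b\<in>range v. (x \<bullet> b) *\<^sub>R b) = x"
    using norm1 by (intro orthonormal_basis_expand pw) auto
  then have x: "x = (\<Sum>i\<in>UNIV. (x \<bullet> v i) *\<^sub>R v i)" by (simp add: sum.reindex[OF inj])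
  have "x \<bullet> x = x \<bullet> (\<Sum>i\<in>UNIV. (x \<bullet> v i) *\<^sub>R v i)" by (rule arg_cong[OF x])
  then show "x \<bullet> x = (\<Sum>i\<in>UNIV. (x \<bullet> v i)\<^sup>2)"
    by (simp add: inner_sum_right power2_eq_square)
  have "A *v x = (\<Sum>i\<in>UNIV. A *v ((x \<bullet> v i) *\<^sub>R v i))"
    by (subst x) (simp add: linear_sum[OF matrix_vector_mul_linear])
  then show "(A *v x) \<bullet> x = (\<Sum>i\<in>UNIV. \<mu> i * (x \<bullet> v i)\<^sup>2)"
    by (simp add: inner_sum_left inner_commute[of x] linear_cmul[OF matrix_vector_mul_linear] eig
        power2_eq_square algebra_simps)
  show "x \<bullet> v i = 0" if "x \<in> span (v ` I)" "i \<notin> I"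
  proof -
    have "\<And>y. y \<in> v ` I \<Longrightarrow> orthogonal (v i) y" using orth that by (auto simp: orthogonal_def)
    from orthogonal_to_span[OF that(1) this] show ?thesis by (simp add: orthogonal_def inner_commute)
  qed
qed

text \<open>The two extremal subspaces behind the Courant-Fischer principle: \<open>V\<close> is
  spanned by the eigenvectors with eigenvalue at most \<open>\<lambda>\<^sub>k\<close>,
  \<open>W\<close> by those with eigenvalue at least \<open>\<lambda>\<^sub>k\<close>.\<close>

lemma nth_eigenvalue_subspaces:
  fixes A :: "real ^ 'n ^ 'n"
  assumes A: "transpose A = A" and k: "1 \<le> k" "k \<le> CARD('n)"
  obtains V W where "subspace V" "k \<le> dim V" "\<And>x. x \<in> V \<Longrightarrow> (A *v x) \<bullet> x \<le> nth_eigenvalue k A * (x \<bullet> x)"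
    "subspace W" "CARD('n) + 1 \<le> k + dim W" "\<And>x. x \<in> W \<Longrightarrow> nth_eigenvalue k A * (x \<bullet> x) \<le> (A *v x) \<bullet> x"
proof -
  obtain v :: "'n \<Rightarrow> real ^ 'n" and \<mu> where orth: "\<And>i j. v i \<bullet> v j = (if i = j then 1 else 0)"
    and eig: "\<And>i. A *v v i = \<mu> i *\<^sub>R v i"
    using symmetric_matrix_eigenbasis[OF A] by metis
  note form = orthonormal_eigenbasis_form[OF orth eig]
  define \<Lambda> where "\<Lambda> = nth_eigenvalue k A"
  note count = nth_eigenvalue_count[OF orth eig k, folded \<Lambda>_def]
  show thesis
  proof (rule that[of "span (v ` {i. \<mu> i \<le> \<Lambda>})" "span (v ` {i. \<Lambda> \<le> \<mu> i})"], goal_cases)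
    case (3 x)
    \<comment> \<open>If \<open>\<mu> i > \<Lambda>\<close>, then \<open>v i\<close> is orthogonal
      to the span and both sides vanish.\<close>
    have "\<mu> i * (x \<bullet> v i)\<^sup>2 \<le> \<Lambda> * (x \<bullet> v i)\<^sup>2" for i
      using form(4)[OF 3, of i] by (cases "\<mu> i \<le> \<Lambda>") (auto intro: mult_right_mono)
    then show ?case by (simp add: form(1,2) \<Lambda>_def[symmetric] sum_distrib_left sum_mono)
  next
    case (6 x)
    have "\<Lambda> * (x \<bullet> v i)\<^sup>2 \<le> \<mu> i * (x \<bullet> v i)\<^sup>2" for i
      using form(4)[OF 6, of i] by (cases "\<Lambda> \<le> \<mu> i") (auto intro: mult_right_mono)
    then show ?case by (simp add: form(1,2) \<Lambda>_def[symmetric] sum_distrib_left sum_mono)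
  qed (use count form(3) in auto)
qed

lemma subspaces_common_vector:
  fixes V W :: "'a::euclidean_space set"
  assumes "subspace V" "subspace W" "DIM('a) < dim V + dim W"
  obtains x where "x \<in> V" "x \<in> W" "x \<noteq> 0"
proof -
  have "dim {x + y |x y. x \<in> V \<and> y \<in> W} \<le> DIM('a)" by (rule dim_subset_UNIV)
  then have "dim (V \<inter> W) \<noteq> 0" using dim_sums_Int[OF assms(1,2)] assms(3) by linarith
  then show thesis using that by (auto simp: dim_eq_0)
qed

text \<open>By the dimension count, \<open>V\<close> shares a nonzero vector with the upper extremal
  subspace \<open>W\<close>; there the form lies between
  \<open>\<lambda>\<^sub>k |x|\<^sup>2\<close> and \<open>0\<close>.\<close>

lemma nth_eigenvalue_nonpos:
  fixes A :: "real ^ 'n ^ 'n"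
  assumes A: "transpose A = A" and k: "1 \<le> k" "k \<le> CARD('n)"
    and V: "subspace V" "k \<le> dim V" "\<And>x. x \<in> V \<Longrightarrow> (A *v x) \<bullet> x \<le> 0"
  shows "nth_eigenvalue k A \<le> 0"
proof -
  obtain W where W: "subspace W" "CARD('n) + 1 \<le> k + dim W"
    "\<And>x. x \<in> W \<Longrightarrow> nth_eigenvalue k A * (x \<bullet> x) \<le> (A *v x) \<bullet> x"
    using nth_eigenvalue_subspaces[OF A k] by metis
  then obtain x where x: "x \<in> V" "x \<in> W" "x \<noteq> 0"
    using subspaces_common_vector[OF V(1) W(1)] V(2) by auto
  then have "nth_eigenvalue k A * (x \<bullet> x) \<le> 0" using V(3) W(3) by (meson order_trans)
  with \<open>x \<noteq> 0\<close> show ?thesis by (auto simp: mult_le_0_iff)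
    (metis inner_gt_zero_iff not_less)
qed

text \<open>The dual count: \<open>W\<close> shares a nonzero vector with the lower extremal
  subspace, where the form is positive and at most
  \<open>\<lambda>\<^sub>k |x|\<^sup>2\<close>.\<close>

lemma nth_eigenvalue_pos:
  fixes A :: "real ^ 'n ^ 'n"
  assumes A: "transpose A = A" and k: "1 \<le> k" "k \<le> CARD('n)"
    and W: "subspace W" "CARD('n) + 1 \<le> k + dim W" "\<And>x. x \<in> W \<Longrightarrow> x \<noteq> 0 \<Longrightarrow> 0 < (A *v x) \<bullet> x"
  shows "0 < nth_eigenvalue k A"
proof -
  obtain V where V: "subspace V" "k \<le> dim V"
    "\<And>x. x \<in> V \<Longrightarrow> (A *v x) \<bullet> x \<le> nth_eigenvalue k A * (x \<bullet> x)"
    using nth_eigenvalue_subspaces[OF A k] by metis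
  then obtain x where x: "x \<in> V" "x \<in> W" "x \<noteq> 0"
    using subspaces_common_vector[OF V(1) W(1)] W(2) by auto
  then have "0 < nth_eigenvalue k A * (x \<bullet> x)" using V(3) W(3) by (meson less_le_trans)
  with \<open>x \<noteq> 0\<close> show ?thesis by (auto simp: zero_less_mult_iff)
    (meson inner_ge_zero not_less)
qed

subsection \<open>Second order calculus\<close>

lemma has_derivative_gradient:
  fixes f :: "real ^ 'n \<Rightarrow> real"
  assumes "f differentiable (at x)"
  shows "(f has_derivative (\<lambda>h. gradient f x \<bullet> h)) (at x)"
proof -
  have D: "(f has_derivative frechet_derivative f (at x)) (at x)"
    using assms frechet_derivative_works by blast
  have "frechet_derivative f (at x) h = gradient f x \<bullet> h" for h
  proof -
    have lin: "linear (frechet_derivative f (at x))" by (rule has_derivative_linear[OF D])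
    have "frechet_derivative f (at x) h = frechet_derivative f (at x) (\<Sum>i\<in>UNIV. h $ i *\<^sub>R axis i 1)"
      by (simp add: basis_expansion flip: scalar_mult_eq_scaleR)
    then show ?thesis
      by (simp add: linear_sum[OF lin] linear_cmul[OF lin] gradient_def inner_vec_def mult.commute)
  qed
  then show ?thesis using D by (metis (no_types, lifting) ext)
qed

lemma gradient_eqI:
  fixes f :: "real ^ 'n \<Rightarrow> real"
  assumes "(f has_derivative (\<lambda>h. g \<bullet> h)) (at x)"
  shows "gradient f x = g"
  by (simp add: gradient_def frechet_derivative_at[OF assms, symmetric] vec_eq_iff inner_axis)

lemma has_derivative_hessian:
  assumes "gradient f differentiable (at x)"
  shows "(gradient f has_derivative (\<lambda>h. hessian f x *v h)) (at x)"
  using assms unfolding hessian_def jacobian_works .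

lemma has_derivative_at_bound:
  fixes f :: "'a::real_normed_vector \<Rightarrow> 'b::real_normed_vector"
  assumes "(f has_derivative f') (at x)" "e > 0"
  obtains d where "d > 0" "\<And>h. norm h < d \<Longrightarrow> norm (f (x + h) - f x - f' h) \<le> e * norm h"
proof -
  obtain d where "d > 0" and d: "\<And>y. norm (y - x) < d \<Longrightarrow> norm (f y - f x - f' (y - x)) \<le> e * norm (y - x)"
    using assms unfolding has_derivative_at_alt by blast
  then show thesis using d[of "x + _"] by (intro that[of d]) auto
qed

section \<open>Taylor expansion and symmetry of the Hessian\<close>

lemma mvt_abs_bound:
  fixes u :: "real \<Rightarrow> real"
  assumes "\<And>s. 0 \<le> s \<Longrightarrow> s \<le> 1 \<Longrightarrow> (u has_real_derivative u' s) (at s)"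
    and "\<And>s. 0 \<le> s \<Longrightarrow> s \<le> 1 \<Longrightarrow> \<bar>u' s\<bar> \<le> B"
  shows "\<bar>u 1 - u 0\<bar> \<le> B"
proof -
  obtain z where "0 < z" "z < 1" "u 1 - u 0 = (1 - 0) * u' z"
    using MVT2[of 0 1 u u'] assms(1) by auto
  then show ?thesis using assms(2)[of z] by simp
qed

lemma has_real_derivative_along_line:
  fixes f :: "real ^ 'n \<Rightarrow> real"
  assumes "f differentiable (at (a + s *\<^sub>R h))"
  shows "((\<lambda>s. f (a + s *\<^sub>R h)) has_real_derivative gradient f (a + s *\<^sub>R h) \<bullet> h) (at s)"
proof -
  have "((\<lambda>s. a + s *\<^sub>R h) has_derivative (\<lambda>t. t *\<^sub>R h)) (at s)"
    by (auto intro!: derivative_eq_intros)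
  from has_derivative_compose[OF this has_derivative_gradient[OF assms]]
  show ?thesis by (simp add: has_field_derivative_def mult.commute[of _ "_ \<bullet> _"])
qed

text \<open>Along the segment from \<open>p\<close> to \<open>p + h\<close> the remainder
  \<open>u\<close> has as derivative the error of linearizing the gradient at \<open>p\<close>,
  paired with \<open>h\<close>. This is at most \<open>e |h|\<^sup>2\<close>, and the mean value
  theorem transfers the bound to \<open>u\<close>.\<close>

lemma second_order_taylor:
  fixes f :: "real ^ 'n \<Rightarrow> real"
  assumes S: "open S" "p \<in> S" and diff: "\<And>x. x \<in> S \<Longrightarrow> f differentiable (at x)"
    and grad: "gradient f differentiable (at p)" and e: "e > 0"
  obtains d where "d > 0"
    "\<And>h. norm h < d \<Longrightarrow>
      \<bar>f (p + h) - f p - gradient f p \<bullet> h - (hessian f p *v h) \<bullet> h / 2\<bar> \<le> e * (norm h)\<^sup>2"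
proof -
  obtain d1 where d1: "d1 > 0" "ball p d1 \<subseteq> S" using S open_contains_ball by blast
  obtain d2 where "d2 > 0" and d2: "\<And>h. norm h < d2 \<Longrightarrow>
      norm (gradient f (p + h) - gradient f p - hessian f p *v h) \<le> e * norm h"
    using has_derivative_at_bound[OF has_derivative_hessian[OF grad] e] by blast
  show thesis
  proof (rule that[of "min d1 d2"])
    show "0 < min d1 d2" using d1 \<open>d2 > 0\<close> by auto
    fix h :: "real ^ 'n" assume h: "norm h < min d1 d2"
    define u where "u s = f (p + s *\<^sub>R h) - s * (gradient f p \<bullet> h) - s\<^sup>2 * ((hessian f p *v h) \<bullet> h / 2)" for s
    have small: "norm (s *\<^sub>R h) \<le> norm h" if "0 \<le> s" "s \<le> 1" for s
      using that by (simp add: mult_left_le_one_le)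
    have "\<bar>u 1 - u 0\<bar> \<le> e * (norm h)\<^sup>2"
    proof (rule mvt_abs_bound)
      fix s :: real assume s: "0 \<le> s" "s \<le> 1"
      then have "p + s *\<^sub>R h \<in> S" using small[OF s] h d1 by (auto simp: dist_norm intro!: subsetD[OF d1(2)])
      from has_real_derivative_along_line[OF diff[OF this]]
      show "(u has_real_derivative (gradient f (p + s *\<^sub>R h) - gradient f p - hessian f p *v (s *\<^sub>R h)) \<bullet> h) (at s)"
        unfolding u_def
        by (auto intro!: derivative_eq_intros simp: inner_simps linear_cmul[OF matrix_vector_mul_linear])
      have "\<bar>(gradient f (p + s *\<^sub>R h) - gradient f p - hessian f p *v (s *\<^sub>R h)) \<bullet> h\<bar>
          \<le> norm (gradient f (p + s *\<^sub>R h) - gradient f p - hessian f p *v (s *\<^sub>R h)) * norm h"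
        by (rule Cauchy_Schwarz_ineq2)
      also have "\<dots> \<le> (e * norm (s *\<^sub>R h)) * norm h"
        using small[OF s] h by (intro mult_right_mono d2) auto
      also have "\<dots> \<le> (e * norm h) * norm h"
        using small[OF s] e by (intro mult_right_mono mult_left_mono) auto
      finally show "\<bar>(gradient f (p + s *\<^sub>R h) - gradient f p - hessian f p *v (s *\<^sub>R h)) \<bullet> h\<bar> \<le> e * (norm h)\<^sup>2"
        by (simp add: power2_eq_square mult.assoc)
    qed
    then show "\<bar>f (p + h) - f p - gradient f p \<bullet> h - (hessian f p *v h) \<bullet> h / 2\<bar> \<le> e * (norm h)\<^sup>2"
      by (simp add: u_def algebra_simps)
  qed
qed

text \<open>
  The second difference \<open>f (p + k + h) - f (p + h) - f (p + k) + f p\<close> is symmetric in \<open>h\<close> and \<open>k\<close>, and it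
  equals \<open>(hessian f p *v k) \<bullet> h\<close> up to an error of second order.
\<close>

lemma hessian_symmetric_inner:
  fixes f :: "real ^ 'n \<Rightarrow> real"
  assumes S: "open S" "p \<in> S" and diff: "\<And>x. x \<in> S \<Longrightarrow> f differentiable (at x)"
    and grad: "gradient f differentiable (at p)"
  shows "(hessian f p *v k) \<bullet> h = (hessian f p *v h) \<bullet> k"
proof -
  let ?H = "hessian f p"
  have lim: "\<bar>(?H *v k) \<bullet> h - (?H *v h) \<bullet> k\<bar> \<le> e * (4 * (norm h + norm k)\<^sup>2)" if e: "e > 0" for e
  proof -
    obtain d1 where d1: "d1 > 0" "ball p d1 \<subseteq> S" using S open_contains_ball by blast
    obtain d2 where "d2 > 0" and d2: "\<And>h. norm h < d2 \<Longrightarrow>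
        norm (gradient f (p + h) - gradient f p - ?H *v h) \<le> e * norm h"
      using has_derivative_at_bound[OF has_derivative_hessian[OF grad] e] by blast
    have half: "\<bar>f (p + k + h) - f (p + h) - f (p + k) + f p - (?H *v k) \<bullet> h\<bar> \<le> 2 * e * (norm h + norm k)\<^sup>2"
      if hk: "norm h + norm k < min d1 d2" for h k
    proof -
      define u where "u s = f (p + k + s *\<^sub>R h) - f (p + s *\<^sub>R h) - s * ((?H *v k) \<bullet> h)" for s
      have "\<bar>u 1 - u 0\<bar> \<le> 2 * e * (norm h + norm k)\<^sup>2"
      proof (rule mvt_abs_bound)
        fix s :: real assume s: "0 \<le> s" "s \<le> 1"
        have n1: "norm (s *\<^sub>R h) \<le> norm h + norm k"
          using s by (simp add: add_increasing2 mult_left_le_one_le)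
        have n2: "norm (k + s *\<^sub>R h) \<le> norm h + norm k"
          using s norm_triangle_ineq[of k "s *\<^sub>R h"] mult_left_le_one_le[of "norm h" s] by simp
        have "p + s *\<^sub>R h \<in> S" using n1 hk by (intro subsetD[OF d1(2)]) (simp add: dist_norm)
        moreover have "p + k + s *\<^sub>R h \<in> S"
        proof (rule subsetD[OF d1(2)])
          have "dist p (p + k + s *\<^sub>R h) = norm (k + s *\<^sub>R h)"
            by (metis add.assoc add_diff_cancel_left' dist_commute dist_norm)
          then show "p + k + s *\<^sub>R h \<in> ball p d1" using n2 hk by simp
        qed
        ultimately show "(u has_real_derivative
            (gradient f (p + k + s *\<^sub>R h) - gradient f (p + s *\<^sub>R h) - ?H *v k) \<bullet> h) (at s)"
          unfolding u_def
          by (auto intro!: derivative_eq_intros has_real_derivative_along_line diff simp: inner_simps)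
        \<comment> \<open>The gradient is linearized at \<open>p\<close> only, so both gradients are
          compared with the one at \<open>p\<close>; the terms in \<open>s h\<close> cancel.\<close>
        have eq: "gradient f (p + k + s *\<^sub>R h) - gradient f (p + s *\<^sub>R h) - ?H *v k
          = (gradient f (p + (k + s *\<^sub>R h)) - gradient f p - ?H *v (k + s *\<^sub>R h))
            - (gradient f (p + s *\<^sub>R h) - gradient f p - ?H *v (s *\<^sub>R h))"
          by (simp add: matrix_vector_right_distrib algebra_simps)
        have "norm (gradient f (p + k + s *\<^sub>R h) - gradient f (p + s *\<^sub>R h) - ?H *v k)
          \<le> e * norm (k + s *\<^sub>R h) + e * norm (s *\<^sub>R h)"
          unfolding eq using n1 n2 hk by (intro order_trans[OF norm_triangle_ineq4] add_mono d2) auto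
        also have "\<dots> \<le> e * (norm h + norm k) + e * (norm h + norm k)"
          using n1 n2 e by (intro add_mono mult_left_mono) auto
        finally have grad_diff: "norm (gradient f (p + k + s *\<^sub>R h) - gradient f (p + s *\<^sub>R h) - ?H *v k)
          \<le> 2 * e * (norm h + norm k)" by simp
        have "\<bar>(gradient f (p + k + s *\<^sub>R h) - gradient f (p + s *\<^sub>R h) - ?H *v k) \<bullet> h\<bar>
          \<le> norm (gradient f (p + k + s *\<^sub>R h) - gradient f (p + s *\<^sub>R h) - ?H *v k) * norm h"
          by (rule Cauchy_Schwarz_ineq2)
        also have "\<dots> \<le> 2 * e * (norm h + norm k) * (norm h + norm k)"
          using grad_diff e by (intro mult_mono) auto
        finally show "\<bar>(gradient f (p + k + s *\<^sub>R h) - gradient f (p + s *\<^sub>R h) - ?H *v k) \<bullet> h\<bar>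
          \<le> 2 * e * (norm h + norm k)\<^sup>2" by (simp add: power2_eq_square mult.assoc)
      qed
      then show ?thesis by (simp add: u_def algebra_simps)
    qed
    \<comment> \<open>The estimate is homogeneous of degree two in the pair \<open>(h, k)\<close>.
      It suffices to prove it for the pair scaled by \<open>t\<close> into the admissible ball and
      then to divide by \<open>t\<^sup>2\<close>.\<close>
    define t where "t = min d1 d2 / (norm h + norm k + 1)"
    have "t > 0" using d1 \<open>d2 > 0\<close> by (simp add: t_def add_nonneg_pos)
    have "t * (norm h + norm k) < t * (norm h + norm k + 1)" using \<open>t > 0\<close> by simp
    also have "\<dots> = min d1 d2" by (simp add: t_def add_nonneg_eq_0_iff)
    finally have small: "norm (t *\<^sub>R h) + norm (t *\<^sub>R k) < min d1 d2"
      using \<open>t > 0\<close> by (simp add: algebra_simps)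
    have "\<bar>(?H *v (t *\<^sub>R k)) \<bullet> (t *\<^sub>R h) - (?H *v (t *\<^sub>R h)) \<bullet> (t *\<^sub>R k)\<bar>
        \<le> 4 * e * (norm (t *\<^sub>R h) + norm (t *\<^sub>R k))\<^sup>2"
      using half[of "t *\<^sub>R h" "t *\<^sub>R k"] half[of "t *\<^sub>R k" "t *\<^sub>R h"] small
      by (simp add: add_ac)
    moreover have "(?H *v (t *\<^sub>R k)) \<bullet> (t *\<^sub>R h) - (?H *v (t *\<^sub>R h)) \<bullet> (t *\<^sub>R k)
        = t\<^sup>2 * ((?H *v k) \<bullet> h - (?H *v h) \<bullet> k)"
      by (simp add: linear_cmul[OF matrix_vector_mul_linear] power2_eq_square algebra_simps)
    moreover have "norm (t *\<^sub>R h) + norm (t *\<^sub>R k) = t * (norm h + norm k)"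
      using \<open>t > 0\<close> by (simp add: algebra_simps)
    ultimately have "t\<^sup>2 * \<bar>(?H *v k) \<bullet> h - (?H *v h) \<bullet> k\<bar> \<le> t\<^sup>2 * (e * (4 * (norm h + norm k)\<^sup>2))"
      by (simp add: abs_mult power_mult_distrib mult_ac)
    then show ?thesis using \<open>t > 0\<close> by simp
  qed
  define C where "C = 4 * (norm h + norm k)\<^sup>2 + 1"
  have "C > 0" by (simp add: C_def add_nonneg_pos)
  have "\<bar>(?H *v k) \<bullet> h - (?H *v h) \<bullet> k\<bar> \<le> 0 + \<epsilon>" if "\<epsilon> > 0" for \<epsilon>
  proof -
    have "\<bar>(?H *v k) \<bullet> h - (?H *v h) \<bullet> k\<bar> \<le> \<epsilon> / C * (4 * (norm h + norm k)\<^sup>2)"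
      using that \<open>C > 0\<close> by (intro lim) simp
    also have "\<dots> \<le> \<epsilon> / C * C"
      using that \<open>C > 0\<close> by (intro mult_left_mono) (auto simp: C_def)
    finally show ?thesis using \<open>C > 0\<close> by simp
  qed
  then have "\<bar>(?H *v k) \<bullet> h - (?H *v h) \<bullet> k\<bar> \<le> 0" by (rule field_le_epsilon)
  then show ?thesis by simp
qed

lemma transpose_eq_if_inner_symmetric:
  fixes A :: "real ^ 'n ^ 'n"
  assumes "\<And>x y. (A *v x) \<bullet> y = (A *v y) \<bullet> x"
  shows "transpose A = A"
proof -
  have "A $ i $ j = A $ j $ i" for i j
    using assms[of "axis j 1" "axis i 1"]
    by (simp add: matrix_vector_mult_basis inner_axis column_def)
  then show ?thesis by (simp add: transpose_def vec_eq_iff)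
qed

lemma C2_on_hessian_symmetric:
  assumes "C2_on S f" "open S" "p \<in> S"
  shows "transpose (hessian f p) = hessian f p"
  using assms by (intro transpose_eq_if_inner_symmetric hessian_symmetric_inner[of S]) (auto simp: C2_on_def)

text \<open>The left side is the second derivative at \<open>0\<close> of \<open>f\<close> along the
  curve. As \<open>t\<close> takes both signs, dividing the Taylor inequality by \<open>t\<close>
  from either side first forces \<open>gradient f p \<bullet> w = 0\<close>; dividing by
  \<open>t\<^sup>2\<close> then gives the claim.\<close>

lemma curve_second_order_condition:
  fixes f :: "real ^ 'n \<Rightarrow> real"
  assumes C2: "C2_on S f" "open S" "p \<in> S" and d: "d > 0"
    and max: "\<And>t. \<bar>t\<bar> < d \<Longrightarrow> f (p + t *\<^sub>R w + t\<^sup>2 *\<^sub>R z) \<le> f p"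
  shows "2 * (gradient f p \<bullet> z) + (hessian f p *v w) \<bullet> w \<le> 0"
proof -
  let ?g = "gradient f p" and ?H = "hessian f p"
  \<comment> \<open>The displacement is \<open>t\<close> times \<open>c t\<close>, and
    \<open>c t\<close> tends to \<open>w\<close>; all limits below come from this.\<close>
  define c where "c t = w + t *\<^sub>R z" for t
  define q where "q t = ?g \<bullet> z + (?H *v c t) \<bullet> c t / 2" for t
  have curve: "p + t *\<^sub>R w + t\<^sup>2 *\<^sub>R z = p + t *\<^sub>R c t" for t
    by (simp add: c_def algebra_simps power2_eq_square)
  have c: "(c \<longlongrightarrow> w) (at 0)" unfolding c_def by (auto intro!: tendsto_eq_intros)
  have q: "(q \<longlongrightarrow> ?g \<bullet> z + (?H *v w) \<bullet> w / 2) (at 0)"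
    unfolding q_def by (intro tendsto_intros c
      bounded_linear.tendsto[OF matrix_vector_mul_bounded_linear]) simp
  have bound: "\<forall>\<^sub>F t in at 0. t * (?g \<bullet> w) + t\<^sup>2 * q t \<le> e * (t\<^sup>2 * (norm (c t))\<^sup>2)" if e: "e > 0" for e
  proof -
    have diff: "\<And>x. x \<in> S \<Longrightarrow> f differentiable (at x)" "gradient f differentiable (at p)"
      using C2 by (auto simp: C2_on_def)
    obtain d' where "d' > 0" and d': "\<And>h. norm h < d' \<Longrightarrow>
      \<bar>f (p + h) - f p - ?g \<bullet> h - (?H *v h) \<bullet> h / 2\<bar> \<le> e * (norm h)\<^sup>2"
      using second_order_taylor[OF C2(2,3) diff e] by metis
    have "((\<lambda>t. norm (t *\<^sub>R c t)) \<longlongrightarrow> norm (0 *\<^sub>R w)) (at 0)" by (intro tendsto_intros c)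
    from order_tendstoD(2)[OF this, of d'] \<open>d' > 0\<close> have "\<forall>\<^sub>F t in at 0. norm (t *\<^sub>R c t) < d'" by simp
    moreover have "\<forall>\<^sub>F t in at 0. \<bar>t\<bar> < d" using d by (auto simp: eventually_at dist_real_def)
    ultimately show ?thesis
    proof eventually_elim
      case (elim t)
      have "?g \<bullet> (t *\<^sub>R c t) + (?H *v (t *\<^sub>R c t)) \<bullet> (t *\<^sub>R c t) / 2 \<le> e * (norm (t *\<^sub>R c t))\<^sup>2"
        using d'[OF elim(1)] max[OF elim(2)] unfolding curve by linarith
      moreover have "?g \<bullet> (t *\<^sub>R c t) = t * (?g \<bullet> w) + t\<^sup>2 * (?g \<bullet> z)"
        by (simp add: c_def inner_simps power2_eq_square algebra_simps)
      ultimately show ?case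
        by (simp add: q_def linear_cmul[OF matrix_vector_mul_linear] power_mult_distrib power2_eq_square algebra_simps)
    qed
  qed
  \<comment> \<open>\<open>s\<close> is the sign of \<open>t\<close> along the one-sided filter
    \<open>F\<close>, so that one divides by the positive number \<open>s * t\<close> in both cases.
    The error constant \<open>1\<close> suffices, because the error still vanishes after the
    division.\<close>
  have le0: "s * (?g \<bullet> w) \<le> 0" if "F \<le> at 0" "F \<noteq> bot" "\<forall>\<^sub>F t in F. 0 < s * t" "\<bar>s\<bar> = 1" for s :: real and F
  proof (rule tendsto_le[OF \<open>F \<noteq> bot\<close>])
    have cF: "(c \<longlongrightarrow> w) F" and qF: "(q \<longlongrightarrow> ?g \<bullet> z + (?H *v w) \<bullet> w / 2) F"
      using c q that(1) by (auto intro: tendsto_mono)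
    have tF: "((\<lambda>t. t) \<longlongrightarrow> 0) F" using that(1) by (auto intro: tendsto_mono[OF _ tendsto_ident_at])
    have "((\<lambda>t. (norm (c t))\<^sup>2 * (s * t)) \<longlongrightarrow> (norm w)\<^sup>2 * (s * 0)) F"
      by (intro tendsto_intros cF tF)
    then show "((\<lambda>t. (norm (c t))\<^sup>2 * (s * t)) \<longlongrightarrow> 0) F" by simp
    have "((\<lambda>t. s * (?g \<bullet> w) + s * t * q t)
        \<longlongrightarrow> s * (?g \<bullet> w) + s * 0 * (?g \<bullet> z + (?H *v w) \<bullet> w / 2)) F"
      by (intro tendsto_intros qF tF)
    then show "((\<lambda>t. s * (?g \<bullet> w) + s * t * q t) \<longlongrightarrow> s * (?g \<bullet> w)) F" by simp
    have "\<forall>\<^sub>F t in F. t * (?g \<bullet> w) + t\<^sup>2 * q t \<le> 1 * (t\<^sup>2 * (norm (c t))\<^sup>2)"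
      using bound[of 1] that(1) by (auto intro: filter_leD)
    with that(3) show "\<forall>\<^sub>F t in F. s * (?g \<bullet> w) + s * t * q t \<le> (norm (c t))\<^sup>2 * (s * t)"
    proof eventually_elim
      case (elim t)
      have "s * s = 1" using that(4) by (metis abs_mult_self_eq mult_1)
      then have "s * t * (s * (?g \<bullet> w) + s * t * q t) = t * (?g \<bullet> w) + t\<^sup>2 * q t"
        "s * t * ((norm (c t))\<^sup>2 * (s * t)) = t\<^sup>2 * (norm (c t))\<^sup>2"
        by (algebra)+
      with elim show ?case by (metis mult_1 mult_le_cancel_left_pos)
    qed
  qed
  have "?g \<bullet> w \<le> 0"
    using le0[of "at_right 0" 1] by (simp add: at_le eventually_at_right_less)
  moreover have "- (?g \<bullet> w) \<le> 0"
  proof -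
    have "\<forall>\<^sub>F t in at_left 0. 0 < -1 * (t :: real)"
      unfolding eventually_at_left_field by (rule exI[of _ "-1"]) simp
    then show ?thesis using le0[of "at_left 0" "-1"] by (simp add: at_le)
  qed
  ultimately have g0: "?g \<bullet> w = 0" by simp
  have "?g \<bullet> z + (?H *v w) \<bullet> w / 2 \<le> 0 + \<epsilon>" if "\<epsilon> > 0" for \<epsilon>
  proof -
    \<comment> \<open>Chosen so that the limiting Taylor error \<open>e |w|\<^sup>2\<close> is at
      most \<open>\<epsilon>\<close>; the summand \<open>1\<close> covers
      \<open>w = 0\<close>.\<close>
    define e where "e = \<epsilon> / ((norm w)\<^sup>2 + 1)"
    have "e > 0" using that by (simp add: e_def add_nonneg_pos)
    have "\<forall>\<^sub>F t in at 0. q t \<le> e * (norm (c t))\<^sup>2"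
      using bound[OF \<open>e > 0\<close>] eventually_neq_at_within[of 0]
    proof eventually_elim
      case (elim t)
      then have "t\<^sup>2 * q t \<le> t\<^sup>2 * (e * (norm (c t))\<^sup>2)" by (simp add: g0 mult_ac)
      with elim show ?case by simp
    qed
    moreover have "((\<lambda>t. e * (norm (c t))\<^sup>2) \<longlongrightarrow> e * (norm w)\<^sup>2) (at 0)"
      by (intro tendsto_intros c)
    ultimately have "?g \<bullet> z + (?H *v w) \<bullet> w / 2 \<le> e * (norm w)\<^sup>2"
      using q by (intro tendsto_le[of "at 0"]) auto
    also have "\<dots> \<le> e * ((norm w)\<^sup>2 + 1)" using \<open>e > 0\<close> by simp
    also have "\<dots> = \<epsilon>" by (simp add: e_def add_nonneg_eq_0_iff)
    finally show ?thesis by simp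
  qed
  then have "?g \<bullet> z + (?H *v w) \<bullet> w / 2 \<le> 0" by (rule field_le_epsilon)
  then show ?thesis by simp
qed

subsection \<open>Graph coordinates and the two implications\<close>

text \<open>By polarization \<open>Q\<close> preserves inner products, so its adjoint is a left
  inverse; equality of dimensions makes it two-sided.\<close>

lemma isometry_inverse:
  fixes Q :: "'a::euclidean_space \<Rightarrow> 'b::euclidean_space"
  assumes Q: "linear Q" "\<And>x. norm (Q x) = norm x" and dim: "DIM('a) = DIM('b)"
  obtains Q' where "linear Q'" "\<And>x. Q' (Q x) = x" "\<And>y. Q (Q' y) = y" "\<And>x y. Q' y \<bullet> x = y \<bullet> Q x"
proof -
  have inner: "Q x \<bullet> Q y = x \<bullet> y" for x y
    by (simp add: dot_norm Q flip: linear_add[OF Q(1)])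
  have adj: "adjoint Q y \<bullet> x = y \<bullet> Q x" for x y
    by (metis adjoint_works[OF Q(1)] inner_commute)
  have left: "adjoint Q (Q x) = x" for x
    by (metis adj inner vector_eq_rdot)
  then have "inj Q" by (metis injI)
  then have "dim (range Q) = DIM('b)" by (simp add: dim_image_eq[OF Q(1)] dim_UNIV dim)
  then have "surj Q"
    by (metis Q(1) dim_eq_full linear_subspace_image span_eq_iff subspace_UNIV)
  then have "Q (adjoint Q y) = y" for y by (metis left surjD)
  with that[OF adjoint_linear[OF Q(1)] left _ adj] show thesis by blast
qed

text \<open>Since \<open>T p = 0\<close>, the rigid transformation is \<open>T x = Q (x - p)\<close>
  with inverse \<open>y \<mapsto> p + Q' y\<close>. From here on only this inverse chart is
  used.\<close>

lemma local_graph_chart: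
  fixes \<Omega> U :: "(real ^ 'n) set" and T :: "real ^ 'n \<Rightarrow> (real ^ 'm) \<times> real"
  assumes card: "CARD('n) = CARD('m) + 1" and g: "local_graph \<Omega> U p T r f"
  obtains Q :: "real ^ 'n \<Rightarrow> (real ^ 'm) \<times> real" and Q'
  where "linear Q" "linear Q'" "\<And>x. Q' (Q x) = x" "\<And>y. Q (Q' y) = y"
    "\<And>x. norm (Q x) = norm x" "\<And>x y. Q' y \<bullet> x = y \<bullet> Q x"
    "\<And>y. norm y < r \<Longrightarrow> p + Q' y \<in> \<Omega>"
    "\<And>y. norm y < r \<Longrightarrow> p + Q' y \<in> U \<longleftrightarrow> f (fst y) < snd y"
proof -
  obtain Q b where Q: "linear Q" "\<And>x. norm (Q x) = norm x" and T: "\<And>x. T x = Q x + b"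
    using g unfolding local_graph_def rigid_transformation_def by blast
  have "DIM(real ^ 'n) = DIM((real ^ 'm) \<times> real)" using card by simp
  from isometry_inverse[OF Q this] obtain Q' where Q': "linear Q'" "\<And>x. Q' (Q x) = x"
    "\<And>y. Q (Q' y) = y" "\<And>x y. Q' y \<bullet> x = y \<bullet> Q x" by metis
  have "b = - Q p" using g T[of p] by (simp add: local_graph_def eq_neg_iff_add_eq_0 add.commute)
  then have TQ: "T (p + Q' y) = y" for y by (simp add: T linear_add[OF Q(1)] Q')
  have "inj T" by (rule injI) (metis T Q'(2) add_right_cancel)
  then have mem: "p + Q' y \<in> S \<longleftrightarrow> y \<in> T ` S" for y S
    by (metis TQ inj_image_mem_iff)
  have \<Omega>: "ball 0 r \<subseteq> T ` \<Omega>" and U: "T ` U \<inter> ball 0 r = {(x', xN). (x', xN) \<in> ball 0 r \<and> xN > f x'}"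
    using g unfolding local_graph_def by blast+
  have "p + Q' y \<in> \<Omega>" if "norm y < r" for y
    using that \<Omega> by (auto simp: mem)
  moreover have "p + Q' y \<in> U \<longleftrightarrow> f (fst y) < snd y" if "norm y < r" for y
  proof -
    have "y \<in> T ` U \<longleftrightarrow> y \<in> T ` U \<inter> ball 0 r" using that by simp
    also have "\<dots> \<longleftrightarrow> f (fst y) < snd y" unfolding U using that by (simp add: case_prod_beta)
    finally show ?thesis by (simp add: mem)
  qed
  ultimately show thesis using that Q Q' by blast
qed

section \<open>Nonnegative curvature and the Hessian of a test function\<close>

lemma second_order_taylor_at_zero:
  fixes f :: "real ^ 'n \<Rightarrow> real"
  assumes "C2_on (ball 0 r) f" "f 0 = 0" "gradient f 0 = 0" "0 < r" "e > 0"
  shows "\<exists>d>0. \<forall>h. norm h < d \<longrightarrow> \<bar>f h - (hessian f 0 *v h) \<bullet> h / 2\<bar> \<le> e * (norm h)\<^sup>2"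
proof (rule second_order_taylor)
  show "open (ball 0 r :: (real ^ 'n) set)" "0 \<in> ball 0 r" using assms(4) by auto
  show "f differentiable (at x)" if "x \<in> ball 0 r" for x using assms(1) that by (simp add: C2_on_def)
  show "gradient f differentiable (at 0)" using assms(1,4) by (simp add: C2_on_def)
  show "e > 0" by fact
  fix d :: real
  assume "d > 0" and d: "\<And>h. norm h < d \<Longrightarrow>
    \<bar>f (0 + h) - f 0 - gradient f 0 \<bullet> h - (hessian f 0 *v h) \<bullet> h / 2\<bar> \<le> e * (norm h)\<^sup>2"
  have "\<bar>f h - (hessian f 0 *v h) \<bullet> h / 2\<bar> \<le> e * (norm h)\<^sup>2" if "norm h < d" for h
    using d[OF that] assms(2,3) by simp
  with \<open>d > 0\<close> show ?thesis by blast
qed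

text \<open>Nonnegativity of \<open>D\<^sup>2f(0)\<close> at \<open>v\<close> only bounds
  \<open>f\<close> from below along the line through \<open>v\<close> up to an error of order
  \<open>o(t\<^sup>2)\<close>, so the tangent line itself may enter \<open>U\<close>. Bending it
  down by \<open>\<epsilon> t\<^sup>2\<close> avoids this, at the price of a multiple of
  \<open>\<epsilon>\<close> times the normal derivative \<open>c\<close> of
  \<open>\<phi>\<close>.\<close>

lemma hessian_nonpos_along_graph:
  fixes \<Omega> U :: "(real ^ 'n) set" and Q' :: "(real ^ 'm) \<times> real \<Rightarrow> real ^ 'n"
  assumes \<phi>: "C2_on \<Omega> \<phi>" "open \<Omega>" "p \<in> \<Omega>" "\<And>x. x \<in> \<Omega> - U \<Longrightarrow> \<phi> x \<le> \<phi> p"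
    and f: "C2_on (ball 0 r) f" "f 0 = 0" "gradient f 0 = 0" "0 < r"
    and Q': "linear Q'" "\<And>y. norm y < r \<Longrightarrow> p + Q' y \<in> \<Omega>"
      "\<And>y. norm y < r \<Longrightarrow> p + Q' y \<in> U \<longleftrightarrow> f (fst y) < snd y"
    and v: "0 \<le> (hessian f 0 *v v) \<bullet> v"
  shows "(hessian \<phi> p *v Q' (v, 0)) \<bullet> Q' (v, 0) \<le> 0"
proof -
  define w where "w = Q' (v, 0)"
  define c where "c = gradient \<phi> p \<bullet> Q' (0, 1)"
  have le: "(hessian \<phi> p *v w) \<bullet> w \<le> 2 * \<epsilon> * c" if \<epsilon>: "\<epsilon> > 0" for \<epsilon>
  proof -
    define e where "e = \<epsilon> / ((norm v)\<^sup>2 + 1)"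
    have "e > 0" using \<epsilon> by (simp add: e_def add_nonneg_pos)
    have "e * (norm v)\<^sup>2 \<le> e * ((norm v)\<^sup>2 + 1)" using \<open>e > 0\<close> by simp
    also have "\<dots> = \<epsilon>" by (simp add: e_def add_nonneg_eq_0_iff)
    finally have e: "e * (norm v)\<^sup>2 \<le> \<epsilon>" .
    obtain d where "d > 0" and d: "\<And>h. norm h < d \<Longrightarrow> \<bar>f h - (hessian f 0 *v h) \<bullet> h / 2\<bar> \<le> e * (norm h)\<^sup>2"
      using second_order_taylor_at_zero[OF f \<open>e > 0\<close>] by blast
    \<comment> \<open>The bound \<open>1\<close> gives \<open>t\<^sup>2 \<le> \<bar>t\<bar>\<close>,
      whence \<open>norm y \<le> \<bar>t\<bar> * (norm v + \<epsilon>)\<close>; the second bound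
      keeps \<open>y\<close> inside both the chart and the Taylor ball.\<close>
    define \<delta> where "\<delta> = min 1 (min r d / (norm v + \<epsilon>))"
    have "norm v + \<epsilon> > 0" using \<epsilon> by (simp add: add_nonneg_pos)
    then have "\<delta> > 0" using f(4) \<open>d > 0\<close> by (simp add: \<delta>_def)
    have "2 * (gradient \<phi> p \<bullet> Q' (0, - \<epsilon>)) + (hessian \<phi> p *v w) \<bullet> w \<le> 0"
    proof (rule curve_second_order_condition[OF \<phi>(1-3) \<open>\<delta> > 0\<close>])
      fix t :: real assume t: "\<bar>t\<bar> < \<delta>"
      define y where "y = (t *\<^sub>R v, - \<epsilon> * t\<^sup>2)"
      have "y = t *\<^sub>R (v, 0) + t\<^sup>2 *\<^sub>R (0, - \<epsilon>)" by (simp add: y_def)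
      then have curve: "p + t *\<^sub>R w + t\<^sup>2 *\<^sub>R Q' (0, - \<epsilon>) = p + Q' y"
        by (simp only: w_def linear_add[OF Q'(1)] linear_cmul[OF Q'(1)] add.assoc)
      have "\<bar>t\<bar> * \<bar>t\<bar> \<le> 1 * \<bar>t\<bar>" using t by (intro mult_right_mono) (auto simp: \<delta>_def)
      then have "t\<^sup>2 \<le> \<bar>t\<bar>" by (simp add: power2_eq_square)
      have "norm y \<le> \<bar>t\<bar> * norm v + \<epsilon> * t\<^sup>2"
        unfolding y_def using norm_Pair_le[of "t *\<^sub>R v" "- \<epsilon> * t\<^sup>2"] \<epsilon> by (simp add: abs_mult)
      also have "\<dots> \<le> \<bar>t\<bar> * norm v + \<epsilon> * \<bar>t\<bar>"
        using \<open>t\<^sup>2 \<le> \<bar>t\<bar>\<close> \<epsilon> by simp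
      also have "\<dots> = \<bar>t\<bar> * (norm v + \<epsilon>)" by (simp add: algebra_simps)
      also have "\<dots> < min r d"
        using t \<open>norm v + \<epsilon> > 0\<close> by (simp only: \<delta>_def min_less_iff_conj pos_less_divide_eq)
      finally have y: "norm y < r" "norm y < d" by auto
      have "norm (t *\<^sub>R v) < d" using norm_fst_le[of "t *\<^sub>R v" "- \<epsilon> * t\<^sup>2"] y unfolding y_def by linarith
      from d[OF this] have "t\<^sup>2 * ((hessian f 0 *v v) \<bullet> v) / 2 - e * (t\<^sup>2 * (norm v)\<^sup>2) \<le> f (t *\<^sub>R v)"
        by (simp add: linear_cmul[OF matrix_vector_mul_linear] power_mult_distrib power2_eq_square[of t]
            mult.assoc abs_le_iff)
      moreover have "t\<^sup>2 * (e * (norm v)\<^sup>2) \<le> t\<^sup>2 * \<epsilon>" by (intro mult_left_mono e) simp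
      moreover have "0 \<le> t\<^sup>2 * ((hessian f 0 *v v) \<bullet> v)" using v by simp
      ultimately have "- \<epsilon> * t\<^sup>2 \<le> f (t *\<^sub>R v)" by (simp add: mult_ac)
      then have "p + Q' y \<in> \<Omega> - U" using Q'(2,3)[OF y(1)] by (simp add: y_def not_less)
      then show "\<phi> (p + t *\<^sub>R w + t\<^sup>2 *\<^sub>R Q' (0, - \<epsilon>)) \<le> \<phi> p"
        unfolding curve by (rule \<phi>(4))
    qed
    moreover have "Q' (0, - \<epsilon>) = (- \<epsilon>) *\<^sub>R Q' (0, 1)"
      by (simp flip: linear_cmul[OF Q'(1)])
    ultimately show ?thesis by (simp add: c_def)
  qed
  have "(hessian \<phi> p *v w) \<bullet> w \<le> 0 + \<eta>" if "\<eta> > 0" for \<eta>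
  proof -
    have "(hessian \<phi> p *v w) \<bullet> w \<le> \<eta> * (2 * c / (2 * \<bar>c\<bar> + 1))"
      using le[of "\<eta> / (2 * \<bar>c\<bar> + 1)"] that by (simp add: mult_ac)
    also have "\<dots> \<le> \<eta> * 1" using that by (intro mult_left_mono) (auto simp: divide_le_eq)
    finally show ?thesis by simp
  qed
  then show ?thesis unfolding w_def by (rule field_le_epsilon)
qed

section \<open>The quartic test function and the case of negative curvature\<close>

lemma hessian_eqI:
  assumes "(gradient f has_derivative (\<lambda>h. A *v h)) (at x)"
  shows "hessian f x = A"
  unfolding hessian_def jacobian_def frechet_derivative_at[OF assms, symmetric]
  by (rule matrix_of_matrix_vector_mul)

text \<open>The quartic term has vanishing second derivatives at \<open>p\<close>. It can therefore
  force decay far from \<open>p\<close> without affecting the Hessian there.\<close>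

lemma quartic_C2_hessian:
  fixes A :: "real ^ 'n ^ 'n" and e p :: "real ^ 'n" and K :: real
  defines "\<phi> \<equiv> \<lambda>x. e \<bullet> (x - p) + (A *v (x - p)) \<bullet> (x - p) / 2 - K * ((x - p) \<bullet> (x - p))\<^sup>2"
  assumes A: "transpose A = A"
  shows "C2_on S \<phi>" "hessian \<phi> p = A"
proof -
  note [derivative_intros] = bounded_linear.has_derivative[OF matrix_vector_mul_bounded_linear]
  \<comment> \<open>\<open>G\<close> and \<open>M\<close> are gradient and Hessian of
    \<open>\<phi>\<close>. With \<open>y = x - p\<close>, the gradient of
    \<open>K |y|\<^sup>4\<close> is \<open>4 K |y|\<^sup>2 y\<close>, whose derivative in direction
    \<open>h\<close> is \<open>4 K |y|\<^sup>2 h + 8 K (y \<bullet> h) y\<close>.\<close>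
  define G where "G x = e + A *v (x - p) - (4 * K * ((x - p) \<bullet> (x - p))) *\<^sub>R (x - p)" for x
  define M where "M x = A - (4 * K * ((x - p) \<bullet> (x - p))) *\<^sub>R mat 1
    - (8 * K) *\<^sub>R (\<chi> i j. (x - p) $ i * (x - p) $ j)" for x
  have shift: "((\<lambda>x. x - p) has_derivative (\<lambda>h. h)) (at x)" for x
    by (auto intro!: derivative_eq_intros)
  have d\<phi>: "(\<phi> has_derivative (\<lambda>h. G x \<bullet> h)) (at x)" for x
  proof -
    define y where "y = x - p"
    have "((\<lambda>y. e \<bullet> y + (A *v y) \<bullet> y / 2 - K * (y \<bullet> y)\<^sup>2) has_derivative
        (\<lambda>h. (e + A *v y - (4 * K * (y \<bullet> y)) *\<^sub>R y) \<bullet> h)) (at (x - p))"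
      unfolding y_def[symmetric]
    proof (rule has_derivative_eq_rhs)
      show "((\<lambda>y. e \<bullet> y + (A *v y) \<bullet> y / 2 - K * (y \<bullet> y)\<^sup>2) has_derivative
          (\<lambda>h. e \<bullet> h + ((A *v y) \<bullet> h + (A *v h) \<bullet> y) / 2 - K * (4 * (y \<bullet> y) * (y \<bullet> h)))) (at y)"
        by (auto intro!: derivative_eq_intros simp: inner_commute algebra_simps)
      have "(A *v h) \<bullet> y = (A *v y) \<bullet> h" for h
        by (metis symmetric_matrix_inner[OF A] inner_commute)
      then show "(\<lambda>h. e \<bullet> h + ((A *v y) \<bullet> h + (A *v h) \<bullet> y) / 2 - K * (4 * (y \<bullet> y) * (y \<bullet> h)))
          = (\<lambda>h. (e + A *v y - (4 * K * (y \<bullet> y)) *\<^sub>R y) \<bullet> h)"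
        by (intro ext) (simp only: inner_add_left inner_diff_left inner_scaleR_left, simp)
    qed
    from has_derivative_compose[OF shift this] show ?thesis unfolding \<phi>_def G_def y_def .
  qed
  then have grad: "gradient \<phi> = G" by (simp add: gradient_eqI fun_eq_iff)
  have outer: "(\<chi> i j. y $ i * y $ j) *v h = (y \<bullet> h) *\<^sub>R y" for y h :: "real ^ 'n"
    by (simp add: vec_eq_iff matrix_vector_mult_def inner_vec_def sum_distrib_left mult_ac)
  have "M x *v h = A *v h - (4 * K * ((x - p) \<bullet> (x - p))) *\<^sub>R h - (8 * K * ((x - p) \<bullet> h)) *\<^sub>R (x - p)" for x h
    unfolding M_def matrix_vector_mult_diff_rdistrib scaleR_matrix_vector_assoc[symmetric] outer by simp
  then have M: "(\<lambda>h. M x *v h) = (\<lambda>h. A *v h - (4 * K * ((x - p) \<bullet> (x - p))) *\<^sub>R h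
      - (8 * K * ((x - p) \<bullet> h)) *\<^sub>R (x - p))" for x
    by (rule ext)
  have "((\<lambda>y. e + A *v y - (4 * K * (y \<bullet> y)) *\<^sub>R y) has_derivative
      (\<lambda>h. A *v h - (4 * K * (y \<bullet> y)) *\<^sub>R h - (8 * K * (y \<bullet> h)) *\<^sub>R y)) (at y)" for y
    by (auto intro!: derivative_eq_intros simp: inner_commute algebra_simps)
  from has_derivative_compose[OF shift this]
  have dG: "(G has_derivative (\<lambda>h. M x *v h)) (at x)" for x
    unfolding G_def M .
  then have hess: "hessian \<phi> = M" by (simp add: hessian_eqI grad fun_eq_iff)
  have "continuous_on S M" unfolding M_def by (intro continuous_intros)
  then show "C2_on S \<phi>" using d\<phi> dG unfolding C2_on_def grad hess differentiable_def by blast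
  show "hessian \<phi> p = A" by (simp add: hess M_def vec_eq_iff)
qed

text \<open>The test function touches at \<open>p\<close> itself. It must be nonpositive on all of
  \<open>\<Omega> - U\<close>, whereas the graph describes \<open>U\<close> only near
  \<open>p\<close>; hence the separate estimates near and far from \<open>p\<close>.\<close>

lemma negative_curvature_violates_G:
  fixes \<Omega> U :: "(real ^ 'n) set" and T :: "real ^ 'n \<Rightarrow> (real ^ 'm) \<times> real"
  assumes card: "CARD('n) = CARD('m) + 1" and k: "1 \<le> k" "k < CARD('n)"
    and g: "local_graph \<Omega> U p T r f"
    and neg: "nth_eigenvalue (CARD('n) - k) (hessian f 0) < 0"
  shows "\<not> condition_G k \<Omega> U"
proof -
  obtain Q :: "real ^ 'n \<Rightarrow> (real ^ 'm) \<times> real" and Q'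
    where Q: "linear Q" "linear Q'" "\<And>x. Q' (Q x) = x" "\<And>y. Q (Q' y) = y"
      "\<And>x. norm (Q x) = norm x" "\<And>x y. Q' y \<bullet> x = y \<bullet> Q x"
      and \<Omega>: "\<And>y. norm y < r \<Longrightarrow> p + Q' y \<in> \<Omega>"
      and U: "\<And>y. norm y < r \<Longrightarrow> p + Q' y \<in> U \<longleftrightarrow> f (fst y) < snd y"
    by (rule local_graph_chart[OF card g]) (rule that)
  have f: "C2_on (ball 0 r) f" "f 0 = 0" "gradient f 0 = 0" "0 < r"
    using g by (auto simp: local_graph_def)
  have p: "p \<in> \<Omega> - U" using \<Omega>[of 0] U[of 0] f by (simp add: linear_0[OF Q(2)])
  define H where "H = hessian f 0"
  define \<Lambda> where "\<Lambda> = nth_eigenvalue (CARD('n) - k) H"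
  \<comment> \<open>On \<open>V\<close> the form of \<open>H\<close> is at most
    \<open>- 4 * \<epsilon>\<close> times the squared norm. The test function gives up
    \<open>2 * \<epsilon>\<close> of this to absorb Taylor errors, and \<open>2 * \<epsilon>\<close>
    remains for positivity.\<close>
  define \<epsilon> where "\<epsilon> = - \<Lambda> / 4"
  have "\<epsilon> > 0" using neg by (simp add: \<epsilon>_def \<Lambda>_def H_def)
  have H: "transpose H = H" unfolding H_def using f by (intro C2_on_hessian_symmetric) auto
  have index: "1 \<le> CARD('n) - k" "CARD('n) - k \<le> CARD('m)" using k card by auto
  obtain V where V: "subspace V" "CARD('n) - k \<le> dim V" "\<And>x. x \<in> V \<Longrightarrow> (H *v x) \<bullet> x \<le> \<Lambda> * (x \<bullet> x)"
    unfolding \<Lambda>_def using nth_eigenvalue_subspaces[OF H index] by metis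

  \<comment> \<open>\<open>L\<close> is the Hessian of the test function in graph coordinates, \<open>B\<close> the one in \<open>\<real>\<^sup>N\<close>.\<close>
  define L where "L y = (- (H *v fst y) - (2 * \<epsilon>) *\<^sub>R fst y, snd y)" for y :: "(real ^ 'm) \<times> real"
  have "linear L"
    by (rule linearI) (auto simp: L_def matrix_vector_right_distrib linear_cmul[OF matrix_vector_mul_linear] algebra_simps)
  have Lsym: "L y \<bullet> z = L z \<bullet> y" for y z
    using symmetric_matrix_inner[OF H] by (simp add: L_def inner_prod_def inner_simps inner_commute)
  define B where "B = matrix (\<lambda>x. Q' (L (Q x)))"
  have "linear (\<lambda>x. Q' (L (Q x)))"
    using linear_compose[OF linear_compose[OF Q(1) \<open>linear L\<close>] Q(2)] by (simp add: o_def)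
  then have B: "B *v x = Q' (L (Q x))" for x by (simp add: B_def matrix_works)
  have Bsym: "transpose B = B"
    by (rule transpose_eq_if_inner_symmetric) (metis B Q(6) Lsym)
  have form: "(B *v Q' (u, s)) \<bullet> Q' (u, s) = - ((H *v u) \<bullet> u) - 2 * \<epsilon> * (u \<bullet> u) + s\<^sup>2" for u s
    by (simp add: B Q L_def inner_prod_def inner_simps power2_eq_square)
  have pos: "0 < nth_eigenvalue k B"
  proof (rule nth_eigenvalue_pos[OF Bsym])
    have sub: "subspace (V \<times> (UNIV :: real set))" using V(1) by (rule subspace_Times) simp
    then show "subspace (Q' ` (V \<times> UNIV))" by (rule linear_subspace_image[OF Q(2)])
    have "inj Q'" by (metis Q(4) injI)
    then have "dim (Q' ` (V \<times> (UNIV :: real set))) = dim V + 1"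
      by (simp add: dim_image_eq[OF Q(2)] inj_on_subset dim_Times V(1) dim_UNIV)
    then show "CARD('n) + 1 \<le> k + dim (Q' ` (V \<times> (UNIV :: real set)))" using V(2) k by linarith
    fix x assume x: "x \<in> Q' ` (V \<times> UNIV)" "x \<noteq> 0"
    then obtain u s where us: "x = Q' (u, s)" "u \<in> V" by auto
    then have "u \<noteq> 0 \<or> s \<noteq> 0" using x(2) linear_0[OF Q(2)] by (auto simp: zero_prod_def)
    then have "0 < 2 * \<epsilon> * (u \<bullet> u) + s\<^sup>2"
      using \<open>\<epsilon> > 0\<close> by (auto simp: add_pos_nonneg add_nonneg_pos)
    also have "\<dots> \<le> - ((H *v u) \<bullet> u) - 2 * \<epsilon> * (u \<bullet> u) + s\<^sup>2"
      using V(3)[OF us(2)] by (simp add: \<epsilon>_def)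
    finally show "0 < (B *v x) \<bullet> x" unfolding us form .
  qed (use k in auto)

  \<comment> \<open>The unit normal at \<open>p\<close> pointing into \<open>U\<close>.\<close>
  define e where "e = Q' (0, 1)"
  have near: "\<exists>\<delta>>0. \<forall>y. norm y < \<delta> \<longrightarrow> p + y \<notin> U \<longrightarrow> e \<bullet> y + (B *v y) \<bullet> y / 2 \<le> 0"
  proof -
    have "f differentiable (at 0)" using f by (auto simp: C2_on_def)
    \<comment> \<open>The available \<open>\<epsilon> |u|\<^sup>2\<close> is split evenly: one half
      for the Taylor error of \<open>f u\<close>, the other for \<open>(f u)\<^sup>2 / 2\<close>,
      which is controlled by \<open>\<bar>f u\<bar> \<le> sqrt \<epsilon> * norm u\<close>.\<close>
    have "\<epsilon> / 2 > 0" "sqrt \<epsilon> > 0" using \<open>\<epsilon> > 0\<close> by auto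
    obtain d1 where "d1 > 0" and d1: "\<And>h. norm h < d1 \<Longrightarrow> \<bar>f h - (H *v h) \<bullet> h / 2\<bar> \<le> \<epsilon> / 2 * (norm h)\<^sup>2"
      using second_order_taylor_at_zero[OF f \<open>\<epsilon> / 2 > 0\<close>] unfolding H_def by blast
    obtain d2 where "d2 > 0" and "\<And>h. norm h < d2 \<Longrightarrow>
        norm (f (0 + h) - f 0 - gradient f 0 \<bullet> h) \<le> sqrt \<epsilon> * norm h"
      using has_derivative_at_bound[OF has_derivative_gradient[OF \<open>f differentiable (at 0)\<close>] \<open>sqrt \<epsilon> > 0\<close>]
      by blast
    then have d2: "\<bar>f h\<bar> \<le> sqrt \<epsilon> * norm h" if "norm h < d2" for h
      using f(2,3) that by force
    show ?thesis
    proof (intro exI[of _ "min (min d1 d2) (min r 1)"] conjI allI impI)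
      show "0 < min (min d1 d2) (min r 1)" using \<open>d1 > 0\<close> \<open>d2 > 0\<close> f(4) by simp
      fix y assume y: "norm y < min (min d1 d2) (min r 1)" and "p + y \<notin> U"
      obtain u s where us: "Q y = (u, s)" by (metis surj_pair)
      have "y = Q' (u, s)" by (metis us Q(3))
      have "norm u \<le> norm y" "\<bar>s\<bar> \<le> norm y"
        using norm_fst_le[of u s] norm_snd_le[of s u] Q(5)[of y] by (auto simp: us)
      then have small: "norm u < d1" "norm u < d2" "-1 \<le> s" using y by auto
      have "s \<le> f u" using U[of "(u, s)"] \<open>p + y \<notin> U\<close> y Q(5)[of y]
        by (simp add: \<open>y = Q' (u, s)\<close> not_less Q(4))
      \<comment> \<open>\<open>s + s\<^sup>2 / 2\<close> is increasing for \<open>s \<ge> -1\<close>.\<close>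
      then have "0 \<le> (f u - s) * (1 + (f u + s) / 2)" using small(3) by (intro mult_nonneg_nonneg) (auto simp: field_simps)
      then have "s + s\<^sup>2 / 2 \<le> f u + (f u)\<^sup>2 / 2" by (simp add: power2_eq_square field_simps)
      moreover have "f u \<le> (H *v u) \<bullet> u / 2 + \<epsilon> / 2 * (u \<bullet> u)"
        using abs_le_D1[OF d1[OF small(1)]] by (simp add: dot_square_norm)
      moreover have "(f u)\<^sup>2 \<le> \<epsilon> * (u \<bullet> u)"
        using power_mono[OF d2[OF small(2)], of 2] \<open>\<epsilon> > 0\<close> by (simp add: power_mult_distrib dot_square_norm)
      moreover have "e \<bullet> y = s" by (simp add: e_def Q(6) us inner_prod_def)
      ultimately show "e \<bullet> y + (B *v y) \<bullet> y / 2 \<le> 0"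
        using form[of u s] unfolding \<open>y = Q' (u, s)\<close>[symmetric] by (simp add: algebra_simps)
    qed
  qed
  then obtain \<delta> where "\<delta> > 0" and near: "\<And>y. norm y < \<delta> \<Longrightarrow> p + y \<notin> U \<Longrightarrow> e \<bullet> y + (B *v y) \<bullet> y / 2 \<le> 0"
    by blast
  obtain C where "C > 0" and C: "\<And>y. norm (B *v y) \<le> norm y * C"
    using bounded_linear.pos_bounded[OF matrix_vector_mul_bounded_linear[of B]] by blast
  have norm_e: "norm e = 1" unfolding e_def by (metis Q(4,5) norm_Pair norm_zero norm_one power2_eq_square
    add_0 mult_1 power_zero_numeral real_sqrt_one)
  \<comment> \<open>For \<open>a = norm (x - p) \<ge> \<delta>\<close>, the two summands of
    \<open>K a\<^sup>4\<close> dominate the linear part, at most \<open>a\<close>, and the quadratic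
    part, at most \<open>C a\<^sup>2 / 2\<close>.\<close>
  define K where "K = 1 / \<delta> ^ 3 + C / (2 * \<delta>\<^sup>2)"
  have "K > 0" using \<open>\<delta> > 0\<close> \<open>C > 0\<close> by (simp add: K_def add_pos_pos)
  define \<phi> where "\<phi> x = e \<bullet> (x - p) + (B *v (x - p)) \<bullet> (x - p) / 2 - K * ((x - p) \<bullet> (x - p))\<^sup>2" for x
  have "\<phi> x \<le> 0" if "x \<notin> U" for x
  proof (cases "norm (x - p) < \<delta>")
    case True
    then have "e \<bullet> (x - p) + (B *v (x - p)) \<bullet> (x - p) / 2 \<le> 0" using near[of "x - p"] that by simp
    moreover have "0 \<le> K * ((x - p) \<bullet> (x - p))\<^sup>2" using \<open>K > 0\<close> by simp
    ultimately show ?thesis unfolding \<phi>_def by linarith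
  next
    case False
    define a where "a = norm (x - p)"
    have "\<delta> \<le> a" using False by (simp add: a_def)
    have "e \<bullet> (x - p) \<le> a" using norm_cauchy_schwarz[of e "x - p"] by (simp add: norm_e a_def)
    also have "a = 1 / \<delta> ^ 3 * (a * \<delta> ^ 3)" using \<open>\<delta> > 0\<close> by simp
    also have "\<dots> \<le> 1 / \<delta> ^ 3 * (a * a ^ 3)"
      using \<open>\<delta> > 0\<close> \<open>\<delta> \<le> a\<close> by (intro mult_left_mono power_mono) auto
    finally have 1: "e \<bullet> (x - p) \<le> 1 / \<delta> ^ 3 * (a * a ^ 3)" .
    have "(B *v (x - p)) \<bullet> (x - p) \<le> norm (B *v (x - p)) * norm (x - p)" by (rule norm_cauchy_schwarz)
    also have "\<dots> \<le> C * a\<^sup>2" using mult_right_mono[OF C[of "x - p"], of a]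
      by (simp add: a_def power2_eq_square mult_ac)
    also have "\<dots> = C / \<delta>\<^sup>2 * (a\<^sup>2 * \<delta>\<^sup>2)" using \<open>\<delta> > 0\<close> by simp
    also have "\<dots> \<le> C / \<delta>\<^sup>2 * (a\<^sup>2 * a\<^sup>2)"
      using \<open>\<delta> > 0\<close> \<open>\<delta> \<le> a\<close> \<open>C > 0\<close> by (intro mult_left_mono power_mono) auto
    finally have 2: "(B *v (x - p)) \<bullet> (x - p) \<le> C / \<delta>\<^sup>2 * (a\<^sup>2 * a\<^sup>2)" .
    have "((x - p) \<bullet> (x - p))\<^sup>2 = a ^ 4" by (simp add: a_def dot_square_norm flip: power_mult)
    then have "K * ((x - p) \<bullet> (x - p))\<^sup>2 = K * a ^ 4" by simp
    also have "\<dots> = 1 / \<delta> ^ 3 * (a * a ^ 3) + C / \<delta>\<^sup>2 * (a\<^sup>2 * a\<^sup>2) / 2"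
      using \<open>\<delta> > 0\<close> by (simp add: K_def field_simps power2_eq_square power3_eq_cube power4_eq_xxxx)
    finally have quartic: "K * ((x - p) \<bullet> (x - p))\<^sup>2 = \<dots>" .
    have "(B *v (x - p)) \<bullet> (x - p) / 2 \<le> C / \<delta>\<^sup>2 * (a\<^sup>2 * a\<^sup>2) / 2"
      using 2 by (rule divide_right_mono) simp
    with 1 show ?thesis unfolding \<phi>_def quartic diff_le_0_iff_le by (rule add_mono)
  qed
  moreover have "\<phi> p = 0" by (simp add: \<phi>_def)
  moreover have "C2_on \<Omega> \<phi>" "hessian \<phi> p = B"
    using quartic_C2_hessian[OF Bsym, where e = e and p = p and K = K] by (simp_all add: \<phi>_def[abs_def])
  ultimately show ?thesis using p pos unfolding condition_G_def by (metis DiffD2 not_le)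
qed

text \<open>The upper extremal subspace of \<open>D\<^sup>2f(0)\<close> for the index
  \<open>N - k\<close> in dimension \<open>N - 1\<close> has dimension at least
  \<open>(N - 1) + 1 - (N - k) = k\<close>. Its image in the tangent space at \<open>p\<close> is a
  subspace on which the Hessian of \<open>\<phi>\<close> is nonpositive.\<close>

lemma nonneg_curvature_implies_nonpos_eigenvalue:
  fixes \<Omega> U :: "(real ^ 'n) set" and T :: "real ^ 'n \<Rightarrow> (real ^ 'm) \<times> real"
  assumes card: "CARD('n) = CARD('m) + 1" and k: "1 \<le> k" "k < CARD('n)"
    and g: "local_graph \<Omega> U p T r f" and "open \<Omega>"
    and nonneg: "0 \<le> nth_eigenvalue (CARD('n) - k) (hessian f 0)"
    and \<phi>: "C2_on \<Omega> \<phi>" "p \<in> \<Omega>" "\<And>x. x \<in> \<Omega> - U \<Longrightarrow> \<phi> x \<le> \<phi> p"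
  shows "nth_eigenvalue k (hessian \<phi> p) \<le> 0"
proof -
  obtain Q :: "real ^ 'n \<Rightarrow> (real ^ 'm) \<times> real" and Q'
    where Q: "linear Q'" "\<And>y. Q (Q' y) = y"
      and \<Omega>: "\<And>y. norm y < r \<Longrightarrow> p + Q' y \<in> \<Omega>"
      and U: "\<And>y. norm y < r \<Longrightarrow> p + Q' y \<in> U \<longleftrightarrow> f (fst y) < snd y"
    by (rule local_graph_chart[OF card g]) (rule that)
  have f: "C2_on (ball 0 r) f" "f 0 = 0" "gradient f 0 = 0" "0 < r"
    using g by (auto simp: local_graph_def)
  have H: "transpose (hessian f 0) = hessian f 0" using f by (intro C2_on_hessian_symmetric) auto
  have index: "1 \<le> CARD('n) - k" "CARD('n) - k \<le> CARD('m)" using k card by auto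
  obtain W where W: "subspace W" "CARD('m) + 1 \<le> CARD('n) - k + dim W"
    "\<And>v. v \<in> W \<Longrightarrow> nth_eigenvalue (CARD('n) - k) (hessian f 0) * (v \<bullet> v) \<le> (hessian f 0 *v v) \<bullet> v"
    using nth_eigenvalue_subspaces[OF H index] by metis
  have "(hessian \<phi> p *v Q' (v, 0)) \<bullet> Q' (v, 0) \<le> 0" if "v \<in> W" for v
  proof (rule hessian_nonpos_along_graph[OF \<phi>(1) \<open>open \<Omega>\<close> \<phi>(2,3) f Q(1) \<Omega> U])
    show "0 \<le> (hessian f 0 *v v) \<bullet> v"
      using W(3)[OF that] nonneg by (meson inner_ge_zero mult_nonneg_nonneg order_trans)
  qed
  moreover have "subspace (W \<times> {0 :: real})" using W(1) by (rule subspace_Times) simp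
  moreover have "dim (Q' ` (W \<times> {0 :: real})) = dim W"
  proof -
    have "inj Q'" by (metis Q(2) injI)
    then show ?thesis by (simp add: dim_image_eq[OF Q(1)] inj_on_subset dim_Times W(1))
  qed
  ultimately show ?thesis
    using W(2) k card
    by (intro nth_eigenvalue_nonpos[where V = "Q' ` (W \<times> {0})"]
        C2_on_hessian_symmetric[OF \<phi>(1) \<open>open \<Omega>\<close> \<phi>(2)] linear_subspace_image[OF Q(1)]) auto
qed

theorem theorem5:
  fixes \<Omega> U :: "(real ^ 'n::finite) set"
    and \<kappa> :: "nat \<Rightarrow> real ^ 'n \<Rightarrow> real"
    and k :: nat
  assumes "CARD('n) = CARD('m::finite) + 1"
    and "1 \<le> k" and "k < CARD('n)"
    and "open \<Omega>"
    and "smooth_subdomain TYPE('m) \<Omega> U"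
    and "\<And>p. p \<in> \<Omega> \<inter> frontier U \<Longrightarrow> principal_curvatures_at TYPE('m) \<Omega> U p (\<lambda>j. \<kappa> j p)"
  shows "(\<forall>p \<in> \<Omega> \<inter> frontier U. \<kappa> (CARD('n) - k) p \<ge> 0) \<longleftrightarrow> condition_G k \<Omega> U"
proof -
  \<comment> \<open>The chart extracted here is the one that defines the curvature values at
    \<open>p\<close>, so the same \<open>f\<close> enters both implications. The index
    \<open>N - k\<close> lies in the range where \<open>\<kappa>\<close> is prescribed.\<close>
  have graph: "\<exists>T r (f :: real ^ 'm \<Rightarrow> real). local_graph \<Omega> U p T r f
      \<and> \<kappa> (CARD('n) - k) p = nth_eigenvalue (CARD('n) - k) (hessian f 0)"
    if "p \<in> \<Omega> \<inter> frontier U" for p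
  proof -
    have "CARD('n) - k \<in> {1..CARD('m)}" using assms(1-3) by auto
    then show ?thesis using assms(6)[OF that] unfolding principal_curvatures_at_def by blast
  qed
  show ?thesis
  proof (intro iffI ballI)
    fix p assume "condition_G k \<Omega> U" "p \<in> \<Omega> \<inter> frontier U"
    then show "\<kappa> (CARD('n) - k) p \<ge> 0"
      using graph negative_curvature_violates_G[OF assms(1-3)] by (metis not_le)
  next
    assume nonneg: "\<forall>p \<in> \<Omega> \<inter> frontier U. \<kappa> (CARD('n) - k) p \<ge> 0"
    show "condition_G k \<Omega> U"
      unfolding condition_G_def
    proof (intro allI impI, elim conjE)
      fix \<phi> q
      assume \<phi>: "C2_on \<Omega> \<phi>" "q \<in> \<Omega> - U" "\<phi> q = 0" "\<forall>x \<in> \<Omega> - U. \<phi> x \<le> \<phi> q"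
      show "nth_eigenvalue k (hessian \<phi> q) \<le> 0"
      proof (cases "q \<in> frontier U")
        case True
        then obtain T r and f :: "real ^ 'm \<Rightarrow> real" where g: "local_graph \<Omega> U q T r f"
          and \<kappa>: "\<kappa> (CARD('n) - k) q = nth_eigenvalue (CARD('n) - k) (hessian f 0)"
          using graph[of q] \<phi>(2) by blast
        have "0 \<le> nth_eigenvalue (CARD('n) - k) (hessian f 0)"
          unfolding \<kappa>[symmetric] using nonneg True \<phi>(2) by blast
        with g show ?thesis
          using nonneg_curvature_implies_nonpos_eigenvalue[OF assms(1-3) g assms(4) _ \<phi>(1)] \<phi> by blast
      next
        \<comment> \<open>Off the frontier, \<open>q\<close> is exterior to \<open>U\<close> and
          \<open>\<phi>\<close> has an unconstrained local maximum there. Straight lines, the case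
          \<open>z = 0\<close> of the curve condition, show that the whole Hessian is negative
          semidefinite.\<close>
        case False
        then have "q \<in> \<Omega> - closure U"
          using \<phi>(2) interior_subset[of U] by (auto simp: frontier_def)
        then obtain d where "d > 0" and d: "ball q d \<subseteq> \<Omega> - closure U"
          using open_Diff[OF assms(4) closed_closure] open_contains_ball by blast
        have "(hessian \<phi> q *v w) \<bullet> w \<le> 0" for w
        proof -
          have "2 * (gradient \<phi> q \<bullet> 0) + (hessian \<phi> q *v w) \<bullet> w \<le> 0"
          proof (rule curve_second_order_condition[OF \<phi>(1) assms(4)])
            show "0 < d / (norm w + 1)" using \<open>d > 0\<close> by (simp add: add_nonneg_pos)
            fix t assume "\<bar>t\<bar> < d / (norm w + 1)"
            then have "\<bar>t\<bar> * (norm w + 1) < d" by (simp add: pos_less_divide_eq add_nonneg_pos)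
            then have "norm (t *\<^sub>R w) < d" by (simp add: algebra_simps)
            then have "q + t *\<^sub>R w \<in> \<Omega> - U"
              using d closure_subset[of U] by (auto simp: subset_iff dist_norm)
            then show "\<phi> (q + t *\<^sub>R w + t\<^sup>2 *\<^sub>R 0) \<le> \<phi> q" using \<phi>(4) by simp
          qed (use \<phi>(2) in auto)
          then show ?thesis by simp
        qed
        then show ?thesis
          using assms(2-4) \<phi>(1,2)
          by (intro nth_eigenvalue_nonpos[where V = UNIV] C2_on_hessian_symmetric) (auto simp: dim_UNIV)
      qed
    qed
  qed
qed

end
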